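(* Fix $\lambda\in(0,C)$ and assume that for $y\in\mathcal Y_\lambda$, $L_y$ is the rate matrix of an $M/M/C/C$ queue with arrival rate $\rho(y)=\frac{\lambda}{1-y_C}$ and service rate $1$. Let $\rho_\lambda$ be the unique $\rho\in(0,\infty)$ such that $[I,\nu_\rho]=\lambda$. Then: (i) The set $\mathcal Y_\lambda$ is invariant under the dynamical system $\dot y=yL_y$. (ii) $g(y)=h(y|\nu_{\rho_\lambda})$ is a Lyapunov function for this dynamical system on $\mathcal Y_\lambda$. (iii) The sequence of invariant probability distributions $\pi^N$ of the processes $Y^N_{M(N)}$ converges weakly to the Dirac mass at $\nu_{\rho_\lambda}$ as $N,M(N)\to\infty$ with $M(N)/N\to\lambda$.
   Context: $C\ge1$ is an integer. $\mathcal Y=\{y=(y_0,\dots,y_C)\in[0,+\infty)^{C+1}:\sum_{n}y_n=1\}$ is the set of probability measures on $\{0,\dots,C\}$; $[I,y]=\sum_{n=0}^Cny_n$; $\mathcal Y_\lambda=\{y\in\mathcal Y:[I,y]=\lambda\}$ (so $y_C<1$ on $\mathcal Y_\lambda$, since $\lambda<C$). For $\rho>0$, $\nu_\rho(n)=\frac1{Z(\rho)}\frac{\rho^n}{n!}$ for $0\le n\le C$, with $Z(\rho)=\sum_{n=0}^C\rho^n/n!$. Relative entropy: $h(y|y')=\sum_{n=0}^Cy_n\log\frac{y_n}{y_n'}$. $L_y$ is the $(C+1)\times(C+1)$ matrix with $L_y(n,n+1)=\rho(y)$ for $0\le n\le C-1$, $L_y(n,n-1)=n$ for $1\le n\le C$,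 other off-diagonal entries zero, and rows summing to $0$; $yL_y$ is the product of the row vector $y$ by this matrix, and $yL_y\nabla g(y)=\sum_{n=0}^C(yL_y)_n\frac{\partial g}{\partial y_n}(y)$. A Lyapunov function for $\dot y=yL_y$ on $\mathcal Y_\lambda$ is a continuously differentiable, bounded from below, function $g$ on $[0,+\infty)^{C+1}$ such that $yL_y\nabla g(y)\le0$ for all $y\in\mathcal Y_\lambda$, where equality holds only if $yL_y=0$, i.e. only if $y$ is an equilibrium point of the dynamics. The process $Y^N_M$ (with $M<NC$): $M$ customers are present for ever in a system of $N$ nodes, each of capacity $C$ (at most $C$ customers per node), with no external arrivals nor departures. Each customer spends an exponential time with mean one at each visited node, after which he chooses uniformly one new node among those, different from the current node, that are not saturated (i.e. hold fewer than $C$ customers), and moves there; if the current position is the only non-saturated one, the customer does not move. All exponential variables and choices of successive nodes are independent. $Y^N_M(t)=\frac1N\sum_{i=1}^N\delta_{X_i(t)}$, where $X_i(t)$ is the number of customers at node $i$ at time $t$ and $\delta_x$ is the Dirac mass at $x$. $Y^N_M$ is an irreducible Markov jump process on the finite set $\{y\in\mathcal Y:Ny_n\in\mathbb N \text{ for } 0\le n\le C,\ [I,y]=M/N\}$, hence has a unique invariant distribution, denoted $\pi^N$ when $M=M(N)$. It is assumed throughout that $M(N)<NC$.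
   Formalization: Relative entropy is not continuously differentiable where some y_n=0 (its partial derivative there is −∞); in (ii), differentiability on the closed orthant is read with continuous one-sided partial derivatives in [−∞,∞], finite in the interior, and with 0·(−∞)=0 in yL_y∇g. *)

theory Defs
  imports "HOL-Probability.Probability"
begin

text \<open>
  Vectors indexed by \<open>0, \<dots>, C\<close> are functions \<open>nat \<Rightarrow> real\<close> that vanish beyond \<open>C\<close>. The product
  topology of \<open>nat \<Rightarrow> real\<close> induces on them the usual topology of \<open>(C+1)\<close>-dimensional space.
\<close>

definition orthant :: "nat \<Rightarrow> (nat \<Rightarrow> real) set" where
  "orthant C = {y. (\<forall>n\<le>C. 0 \<le> y n) \<and> (\<forall>n>C. y n = 0)}"

definition prob_vectors :: "nat \<Rightarrow> (nat \<Rightarrow> real) set" where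
  "prob_vectors C = {y \<in> orthant C. (\<Sum>n\<le>C. y n) = 1}"

definition mean :: "nat \<Rightarrow> (nat \<Rightarrow> real) \<Rightarrow> real" where
  "mean C y = (\<Sum>n\<le>C. real n * y n)"

definition prob_vectors_mean :: "nat \<Rightarrow> real \<Rightarrow> (nat \<Rightarrow> real) set" where
  "prob_vectors_mean C lam = {y \<in> prob_vectors C. mean C y = lam}"

definition nu :: "nat \<Rightarrow> real \<Rightarrow> nat \<Rightarrow> real" where
  "nu C r n = (if n \<le> C then (r ^ n / fact n) / (\<Sum>k\<le>C. r ^ k / fact k) else 0)"

definition rho_mean :: "nat \<Rightarrow> real \<Rightarrow> real" where
  "rho_mean C lam = (THE r. 0 < r \<and> mean C (nu C r) = lam)"

text \<open>The convention \<open>0 log 0 = 0\<close> is automatic, since \<open>0 * ln x = 0\<close> for every \<open>x\<close>.\<close>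

definition rel_entropy :: "nat \<Rightarrow> (nat \<Rightarrow> real) \<Rightarrow> (nat \<Rightarrow> real) \<Rightarrow> real" where
  "rel_entropy C y y' = (\<Sum>n\<le>C. y n * ln (y n / y' n))"


section \<open>The dynamical system\<close>

definition mmcc_offdiag :: "nat \<Rightarrow> real \<Rightarrow> nat \<Rightarrow> nat \<Rightarrow> real" where
  "mmcc_offdiag C r n m =
     (if m = n + 1 \<and> n < C then r else if n = m + 1 \<and> n \<le> C then real n else 0)"

definition mmcc_matrix :: "nat \<Rightarrow> real \<Rightarrow> nat \<Rightarrow> nat \<Rightarrow> real" where
  "mmcc_matrix C r n m =
     (if m = n then - (\<Sum>k\<in>{..C} - {n}. mmcc_offdiag C r n k) else mmcc_offdiag C r n m)"

definition arrival_rate :: "nat \<Rightarrow> real \<Rightarrow> (nat \<Rightarrow> real) \<Rightarrow> real" where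
  "arrival_rate C lam y = lam / (1 - y C)"

definition L_mat :: "nat \<Rightarrow> real \<Rightarrow> (nat \<Rightarrow> real) \<Rightarrow> nat \<Rightarrow> nat \<Rightarrow> real" where
  "L_mat C lam y = mmcc_matrix C (arrival_rate C lam y)"

definition drift :: "nat \<Rightarrow> real \<Rightarrow> (nat \<Rightarrow> real) \<Rightarrow> nat \<Rightarrow> real" where
  "drift C lam y m = (\<Sum>n\<le>C. y n * L_mat C lam y n m)"

text \<open>
  The vector field is defined by its formula at all vectors (of any sign and any mass) with
  \<open>y C \<noteq> 1\<close>, so that a solution is not confined beforehand to the set whose invariance is claimed.
\<close>

definition drift_dom :: "nat \<Rightarrow> (nat \<Rightarrow> real) set" where
  "drift_dom C = {y. y C \<noteq> 1 \<and> (\<forall>n>C. y n = 0)}"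

definition solution_on ::
  "nat \<Rightarrow> (nat \<Rightarrow> real) set \<Rightarrow> ((nat \<Rightarrow> real) \<Rightarrow> nat \<Rightarrow> real) \<Rightarrow> real set \<Rightarrow> (real \<Rightarrow> nat \<Rightarrow> real) \<Rightarrow> bool"
where
  "solution_on C D F J y \<longleftrightarrow>
     (\<forall>t\<in>J. y t \<in> D \<and>
        (\<forall>n\<le>C. ((\<lambda>s. y s n) has_real_derivative F (y t) n) (at t within J)))"

text \<open>
  Every solution started in \<open>S\<close>, on whatever time interval \<open>[0,T)\<close> it is defined, stays in \<open>S\<close>;
  and from every point of \<open>S\<close> there is a solution for all times, so that this is not vacuous.
\<close>

definition invariant_set ::
  "nat \<Rightarrow> (nat \<Rightarrow> real) set \<Rightarrow> ((nat \<Rightarrow> real) \<Rightarrow> nat \<Rightarrow> real) \<Rightarrow> (nat \<Rightarrow> real) set \<Rightarrow> bool"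
where
  "invariant_set C D F S \<longleftrightarrow>
     (\<forall>y0\<in>S. \<exists>y. y 0 = y0 \<and> solution_on C D F {0..} y) \<and>
     (\<forall>T>0. \<forall>y. y 0 \<in> S \<longrightarrow> solution_on C D F {0..<T} y \<longrightarrow> (\<forall>t\<in>{0..<T}. y t \<in> S))"


section \<open>Lyapunov functions\<close>

text \<open>
  On the boundary of the orthant the relative entropy is not differentiable in the classical
  sense: where \<open>y n = 0\<close>, its one-sided partial derivative with respect to \<open>y n\<close> exists but equals
  \<open>-\<infinity>\<close>. Partial derivatives are therefore taken within the orthant and valued in \<open>[-\<infinity>,\<infinity>]\<close>, and
  continuous differentiability means that they exist and are continuous on the whole closed
  orthant, and are finite on the open orthant (where the notion is the classical one). In
  the scalar product with the vector field, \<open>0 * (-\<infinity>) = 0\<close>.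
\<close>

definition partial_quotient ::
  "((nat \<Rightarrow> real) \<Rightarrow> real) \<Rightarrow> (nat \<Rightarrow> real) \<Rightarrow> nat \<Rightarrow> real \<Rightarrow> ereal" where
  "partial_quotient g y n s = ereal ((g (y(n := s)) - g y) / (s - y n))"

definition partial :: "((nat \<Rightarrow> real) \<Rightarrow> real) \<Rightarrow> nat \<Rightarrow> (nat \<Rightarrow> real) \<Rightarrow> ereal" where
  "partial g n y = Lim (at (y n) within {0..}) (partial_quotient g y n)"

definition C1_on_orthant :: "nat \<Rightarrow> ((nat \<Rightarrow> real) \<Rightarrow> real) \<Rightarrow> bool" where
  "C1_on_orthant C g \<longleftrightarrow>
     continuous_on (orthant C) g \<and>
     (\<forall>n\<le>C.
        (\<forall>y\<in>orthant C. (partial_quotient g y n \<longlongrightarrow> partial g n y) (at (y n) within {0..})) \<and>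
        (\<forall>y\<in>orthant C. (\<forall>k\<le>C. 0 < y k) \<longrightarrow> \<bar>partial g n y\<bar> \<noteq> \<infinity>) \<and>
        continuous_on (orthant C) (partial g n))"

definition lyapunov ::
  "nat \<Rightarrow> ((nat \<Rightarrow> real) \<Rightarrow> nat \<Rightarrow> real) \<Rightarrow> (nat \<Rightarrow> real) set \<Rightarrow> ((nat \<Rightarrow> real) \<Rightarrow> real) \<Rightarrow> bool"
where
  "lyapunov C F S g \<longleftrightarrow>
     C1_on_orthant C g \<and>
     bdd_below (g ` orthant C) \<and>
     (\<forall>y\<in>S. (\<Sum>n\<le>C. ereal (F y n) * partial g n y) \<le> 0) \<and>
     (\<forall>y\<in>S. (\<Sum>n\<le>C. ereal (F y n) * partial g n y) = 0 \<longrightarrow> (\<forall>n\<le>C. F y n = 0))"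


section \<open>The closed network\<close>

text \<open>
  Customers are \<open>0, \<dots>, M-1\<close>, nodes are \<open>0, \<dots>, N-1\<close>; a configuration \<open>z\<close> maps each customer to the
  node he occupies.
\<close>

definition occupancy :: "nat \<Rightarrow> (nat \<Rightarrow> nat) \<Rightarrow> nat \<Rightarrow> nat" where
  "occupancy M z i = card {c. c < M \<and> z c = i}"

definition configs :: "nat \<Rightarrow> nat \<Rightarrow> nat \<Rightarrow> (nat \<Rightarrow> nat) set" where
  "configs C N M = {z \<in> {..<M} \<rightarrow>\<^sub>E {..<N}. \<forall>i<N. occupancy M z i \<le> C}"

definition targets :: "nat \<Rightarrow> nat \<Rightarrow> nat \<Rightarrow> (nat \<Rightarrow> nat) \<Rightarrow> nat \<Rightarrow> nat set" where
  "targets C N M z c = {j. j < N \<and> j \<noteq> z c \<and> occupancy M z j < C}"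

text \<open>
  Infinitesimal generator of the Markov jump process of the configuration: at rate 1, each customer
  \<open>c\<close> jumps to a node chosen uniformly in \<open>targets C N M z c\<close>, and does not move if there is none.
\<close>

definition generator ::
  "nat \<Rightarrow> nat \<Rightarrow> nat \<Rightarrow> ((nat \<Rightarrow> nat) \<Rightarrow> real) \<Rightarrow> (nat \<Rightarrow> nat) \<Rightarrow> real" where
  "generator C N M f z =
     (\<Sum>c<M. \<Sum>j\<in>targets C N M z c. (f (z(c := j)) - f z) / real (card (targets C N M z c)))"

text \<open>
  Transition semigroup, the exponential of \<open>t\<close> times the generator (which is a bounded operator):
  \<open>transition_semigroup C N M t f z\<close> is the expectation of \<open>f\<close> at time \<open>t\<close> for the process started at \<open>z\<close>.
\<close>

definition transition_semigroup ::
  "nat \<Rightarrow> nat \<Rightarrow> nat \<Rightarrow> real \<Rightarrow> ((nat \<Rightarrow> nat) \<Rightarrow> real) \<Rightarrow> (nat \<Rightarrow> nat) \<Rightarrow> real" where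
  "transition_semigroup C N M t f z = (\<Sum>k. t ^ k / fact k * (generator C N M ^^ k) f z)"

definition empirical :: "nat \<Rightarrow> nat \<Rightarrow> (nat \<Rightarrow> nat) \<Rightarrow> nat \<Rightarrow> real" where
  "empirical N M z n = (\<Sum>i<N. of_bool (occupancy M z i = n)) / real N"

definition empirical_states :: "nat \<Rightarrow> nat \<Rightarrow> nat \<Rightarrow> (nat \<Rightarrow> real) set" where
  "empirical_states C N M =
     {y \<in> prob_vectors C. (\<forall>n\<le>C. real N * y n \<in> \<nat>) \<and> mean C y = real M / real N}"

text \<open>
  The process of interest is the empirical measure of the configuration process. A distribution on
  its state space is invariant if the process, whenever it starts with this distribution
  (whatever the underlying configuration distribution \<open>\<mu>\<close>), has this distribution at all times.
\<close>

definition invariant_dist :: "nat \<Rightarrow> nat \<Rightarrow> nat \<Rightarrow> (nat \<Rightarrow> real) pmf \<Rightarrow> bool" where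
  "invariant_dist C N M p \<longleftrightarrow>
     set_pmf p \<subseteq> empirical_states C N M \<and>
     (\<forall>\<mu>. set_pmf \<mu> \<subseteq> configs C N M \<longrightarrow> map_pmf (empirical N M) \<mu> = p \<longrightarrow>
        (\<forall>t\<ge>0. \<forall>y.
           measure_pmf.expectation \<mu> (transition_semigroup C N M t (\<lambda>z. of_bool (empirical N M z = y)))
             = pmf p y))"

definition stationary :: "nat \<Rightarrow> nat \<Rightarrow> nat \<Rightarrow> (nat \<Rightarrow> real) pmf" where
  "stationary C N M = (THE p. invariant_dist C N M p)"

definition weakly_converges_on ::
  "'a::topological_space set \<Rightarrow> (nat \<Rightarrow> 'a pmf) \<Rightarrow> 'a pmf \<Rightarrow> bool" where
  "weakly_converges_on S ps p \<longleftrightarrow>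
     (\<forall>f :: 'a \<Rightarrow> real. continuous_on S f \<longrightarrow> bounded (f ` S) \<longrightarrow>
        (\<lambda>N. measure_pmf.expectation (ps N) f) \<longlonglongrightarrow> measure_pmf.expectation p f)"

end

theory Submission
  imports Defs "HOL-Combinatorics.Permutations"
begin

text \<open>
  The drift is the discrete divergence of the fluxes \<open>\<rho>(y) y\<^sub>n - (n + 1) y\<^sub>n\<^sub>+\<^sub>1\<close>; summing by parts against the
  gradient of the relative entropy gives terms \<open>(a - b) (ln b - ln a) \<le> 0\<close>, the change of reference
  rate being invisible because the fluxes sum to \<open>\<rho>(y) (1 - y\<^sub>C) - \<lambda> = 0\<close>.

  For the network, no limit dynamics is needed. Removing the jumping customer shows that the jumps are
  symmetric, so the uniform distribution on configurations is reversible, and its image is the only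
  invariant distribution of the empirical measure (an invariant density has zero Dirichlet form).
  Under the uniform distribution, the jumps between two nodes balance exactly, conditionally on the
  other nodes. Hence \<open>(n + 1) y\<^sub>n\<^sub>+\<^sub>1 y\<^sub>m - (m + 1) y\<^sub>n y\<^sub>m\<^sub>+\<^sub>1\<close> has second moment \<open>O(1/N)\<close> for all \<open>n, m < C\<close>, and
  the only probability vector of mean \<open>\<lambda>\<close> at which all these quantities vanish is the limit point.
\<close>

section \<open>The drift and the truncated Poisson distributions\<close>

text \<open>For invariance, the obstacle is that the field has a pole at \<open>y C = 1\<close>, is
  only locally Lipschitz, and that solutions might leave the orthant. The mean keeps the pole away:
  \<open>y C \<le> lam / C < 1\<close> for nonnegative \<open>y\<close> of mean \<open>lam\<close>.
  Existence is obtained from a truncated, globally Lipschitz field whose truncation turns out never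
  to act; for arbitrary solutions, the squared negative parts satisfy a Gronwall inequality. For the
  entropy, the obstacle is the boundary, where partial derivatives are \<open>- \<infinity>\<close>.
  A level of probability zero has no outflow, so the drift is nonnegative there and the infinite
  terms all have the good sign. For the network, invariance is demanded for every configuration law
  with the given image, so the semigroup must preserve functions of the empirical measure; this
  comes from relabelling nodes and customers. The order \<open>1 / N\<close> of the second moment
  arises from sums over four nodes, in which only terms with a coincidence of indices
  survive.\<close>

definition flow :: "nat \<Rightarrow> real \<Rightarrow> (nat \<Rightarrow> real) \<Rightarrow> nat \<Rightarrow> real" where
  "flow C r y m = (\<Sum>n\<le>C. y n * mmcc_matrix C r n m)"

text \<open>The identities for \<open>flow\<close> hold for a free rate, so that they also apply to
  the truncated field used for existence.\<close>

lemma drift_eq_flow: "drift C lam y = flow C (arrival_rate C lam y) y"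
  by (simp add: fun_eq_iff drift_def flow_def L_mat_def)

text \<open>Moves change the level by one, so the pairing only sees increments of
  \<open>\<phi>\<close>. An indicator as \<open>\<phi>\<close> gives the coordinates of the field, a
  constant the conservation of mass, the identity the equation of the mean, and the log density
  ratio the entropy dissipation.\<close>

lemma flow_sum:
  "(\<Sum>m\<le>C. flow C r y m * \<phi> m) =
     (\<Sum>n<C. (r * y n - real (Suc n) * y (Suc n)) * (\<phi> (Suc n) - \<phi> n))"
proof -
  let ?o = "mmcc_offdiag C r"
  have L: "y n * mmcc_matrix C r n m =
      y n * ?o n m - (if m = n then y n * (\<Sum>k\<le>C. ?o n k) else 0)" if "n \<le> C" for n m
  proof (cases "m = n")
    case True
    have "(\<Sum>k\<in>{..C} - {n}. ?o n k) = (\<Sum>k\<le>C. ?o n k)"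
      by (rule sum.mono_neutral_left) (auto simp: mmcc_offdiag_def)
    moreover have "?o n n = 0" by (simp add: mmcc_offdiag_def)
    ultimately show ?thesis using True by (simp add: mmcc_matrix_def)
  qed (simp add: mmcc_matrix_def)
  have "flow C r y m = (\<Sum>n\<le>C. y n * ?o n m) - y m * (\<Sum>k\<le>C. ?o m k)" if "m \<le> C" for m
  proof -
    have "flow C r y m =
        (\<Sum>n\<le>C. y n * ?o n m - (if m = n then y n * (\<Sum>k\<le>C. ?o n k) else 0))"
      unfolding flow_def by (rule sum.cong) (auto simp: L)
    also have "\<dots> = (\<Sum>n\<le>C. y n * ?o n m) - y m * (\<Sum>k\<le>C. ?o m k)"
      using that by (simp add: sum_subtractf)
    finally show ?thesis .
  qed
  then have "(\<Sum>m\<le>C. flow C r y m * \<phi> m) =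
      (\<Sum>m\<le>C. (\<Sum>n\<le>C. y n * ?o n m) * \<phi> m) - (\<Sum>m\<le>C. y m * (\<Sum>k\<le>C. ?o m k) * \<phi> m)"
    by (simp add: left_diff_distrib sum_subtractf)
  also have "(\<Sum>m\<le>C. (\<Sum>n\<le>C. y n * ?o n m) * \<phi> m) = (\<Sum>n\<le>C. \<Sum>m\<le>C. y n * ?o n m * \<phi> m)"
    by (subst sum.swap) (simp add: sum_distrib_right)
  also have "\<dots> - (\<Sum>m\<le>C. y m * (\<Sum>k\<le>C. ?o m k) * \<phi> m) =
      (\<Sum>n\<le>C. y n * (\<Sum>m\<le>C. ?o n m * (\<phi> m - \<phi> n)))"
    by (simp add: sum_subtractf[symmetric] sum_distrib_left sum_distrib_right algebra_simps)
  also have "\<dots> = (\<Sum>n\<le>C. (if n < C then y n * r * (\<phi> (Suc n) - \<phi> n) else 0)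
      + (if 0 < n then y n * real n * (\<phi> (n - 1) - \<phi> n) else 0))"
  proof (rule sum.cong)
    fix n assume n: "n \<in> {..C}"
    \<comment> \<open>Truncated subtraction makes \<open>n - 1 = n\<close> at \<open>n = 0\<close>,
      hence the guard \<open>0 < n\<close>.\<close>
    have "(\<Sum>m\<le>C. ?o n m * (\<phi> m - \<phi> n)) =
      (\<Sum>m\<le>C. (if m = Suc n then if n < C then r * (\<phi> (Suc n) - \<phi> n) else 0 else 0)
        + (if m = n - 1 then if 0 < n then real n * (\<phi> (n - 1) - \<phi> n) else 0 else 0))"
      using n by (intro sum.cong) (auto simp: mmcc_offdiag_def)
    also have "\<dots> = (if n < C then r * (\<phi> (Suc n) - \<phi> n) else 0)
        + (if 0 < n then real n * (\<phi> (n - 1) - \<phi> n) else 0)"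
      using n by (auto simp: sum.distrib)
    finally show "y n * (\<Sum>m\<le>C. ?o n m * (\<phi> m - \<phi> n)) =
      (if n < C then y n * r * (\<phi> (Suc n) - \<phi> n) else 0)
        + (if 0 < n then y n * real n * (\<phi> (n - 1) - \<phi> n) else 0)"
      by (simp add: algebra_simps)
  qed simp
  also have "\<dots> = (\<Sum>n<C. y n * r * (\<phi> (Suc n) - \<phi> n))
      + (\<Sum>n<C. y (Suc n) * real (Suc n) * (\<phi> n - \<phi> (Suc n)))"
    unfolding sum.distrib
  proof (rule arg_cong2[where f = "(+)"])
    show "(\<Sum>n\<le>C. if n < C then y n * r * (\<phi> (Suc n) - \<phi> n) else 0)
        = (\<Sum>n<C. y n * r * (\<phi> (Suc n) - \<phi> n))"
      by (simp add: lessThan_Suc_atMost[symmetric])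
    have "(\<Sum>n\<le>C. if 0 < n then y n * real n * (\<phi> (n - 1) - \<phi> n) else 0)
        = (\<Sum>n<Suc C. if 0 < n then y n * real n * (\<phi> (n - 1) - \<phi> n) else 0)"
      by (simp only: lessThan_Suc_atMost)
    then show "(\<Sum>n\<le>C. if 0 < n then y n * real n * (\<phi> (n - 1) - \<phi> n) else 0)
        = (\<Sum>n<C. y (Suc n) * real (Suc n) * (\<phi> n - \<phi> (Suc n)))"
      by (simp add: sum.lessThan_Suc_shift del: sum.lessThan_Suc)
  qed
  also have "\<dots> = (\<Sum>n<C. (r * y n - real (Suc n) * y (Suc n)) * (\<phi> (Suc n) - \<phi> n))"
    by (simp add: sum.distrib[symmetric] algebra_simps)
  finally show ?thesis .
qed

lemma flow_eq:
  assumes "m \<le> C"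
  shows "flow C r y m =
    (if 0 < m then r * y (m - 1) - real m * y m else 0)
    - (if m < C then r * y m - real (Suc m) * y (Suc m) else 0)"
proof -
  let ?J = "\<lambda>n. r * y n - real (Suc n) * y (Suc n)"
  have "flow C r y m = (\<Sum>k\<le>C. flow C r y k * (if k = m then 1 else 0))"
    using assms by (simp add: if_distrib cong: if_cong)
  also have "\<dots> = (\<Sum>n<C. ?J n * ((if Suc n = m then 1 else 0) - (if n = m then 1 else 0)))"
    by (rule flow_sum)
  also have "\<dots> = (\<Sum>n<C. if n = m - 1 then if 0 < m then ?J n else 0 else 0)
      - (\<Sum>n<C. if n = m then ?J n else 0)"
    unfolding sum_subtractf[symmetric] by (intro sum.cong) auto
  finally show ?thesis
    using assms by auto
qed

lemma sum_flow: "(\<Sum>m\<le>C. flow C r y m) = 0"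
  using flow_sum[of C r y "\<lambda>_. 1"] by simp

text \<open>The right side vanishes for mass one, mean \<open>lam\<close> and
  \<open>r = lam / (1 - y C)\<close>: the arrival rate is exactly the one that conserves the
  mean.\<close>

lemma sum_flux:
  "(\<Sum>n<C. r * y n - real (Suc n) * y (Suc n)) = r * ((\<Sum>n\<le>C. y n) - y C) - mean C y"
proof -
  have "mean C y = (\<Sum>n<Suc C. real n * y n)"
    by (simp add: mean_def lessThan_Suc_atMost)
  also have "\<dots> = (\<Sum>n<C. real (Suc n) * y (Suc n))"
    by (simp add: sum.lessThan_Suc_shift del: sum.lessThan_Suc)
  finally have "mean C y = (\<Sum>n<C. real (Suc n) * y (Suc n))" .
  moreover have "(\<Sum>n\<le>C. y n) = (\<Sum>n<C. y n) + y C"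
    by (simp add: lessThan_Suc_atMost[symmetric])
  ultimately show ?thesis
    by (simp add: sum_subtractf sum_distrib_left)
qed

lemma sum_flow_mean:
  "(\<Sum>m\<le>C. flow C r y m * real m) =
     r * ((\<Sum>n\<le>C. y n) - y C) - mean C y"
  using flow_sum[of C r y real] sum_flux[of r y C] by simp

text \<open>Level \<open>C\<close> alone contributes \<open>C * y C\<close> to the mean. This
  separates \<open>y C\<close> from the pole of the arrival rate.\<close>

lemma last_le_of_mean:
  assumes "1 \<le> C" "\<And>n. n \<le> C \<Longrightarrow> 0 \<le> y n" "mean C y \<le> lam"
  shows "y C \<le> lam / real C"
proof -
  have "real C * y C \<le> mean C y"
    unfolding mean_def by (rule member_le_sum) (use assms in auto)
  with assms show ?thesis by (simp add: field_simps)
qed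

lemma last_less_1:
  assumes "1 \<le> C" "lam < real C" "y \<in> prob_vectors_mean C lam"
  shows "y C < 1"
proof -
  have "y C \<le> lam / real C"
    using assms by (intro last_le_of_mean) (auto simp: prob_vectors_mean_def prob_vectors_def orthant_def)
  also have "\<dots> < 1" using assms by simp
  finally show ?thesis .
qed

section \<open>Existence and uniqueness of the rate with prescribed mean\<close>

lemma mean_nu_eq_iff:
  assumes "0 < r"
  shows "mean C (nu C r) = lam \<longleftrightarrow> (\<Sum>n\<le>C. (real n - lam) * (r ^ n / fact n)) = 0"
proof -
  let ?Z = "\<Sum>k\<le>C. r ^ k / fact k"
  have Z: "?Z > 0" using assms by (intro sum_pos) auto
  have "mean C (nu C r) = (\<Sum>n\<le>C. real n * (r ^ n / fact n)) / ?Z"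
    by (simp add: mean_def nu_def sum_divide_distrib)
  then have "mean C (nu C r) = lam \<longleftrightarrow> (\<Sum>n\<le>C. real n * (r ^ n / fact n)) = lam * ?Z"
    using Z by (simp add: divide_eq_eq)
  also have "\<dots> \<longleftrightarrow> (\<Sum>n\<le>C. (real n - lam) * (r ^ n / fact n)) = 0"
    by (simp only: left_diff_distrib sum_subtractf sum_distrib_left right_minus_eq)
  finally show ?thesis .
qed

text \<open>Divided by \<open>r powr lam\<close>, every term of \<open>\<Sum>n. (n - lam) r\<^sup>n / n!\<close> is nondecreasing in \<open>r\<close>.\<close>

lemma mean_nu_inj:
  assumes "0 < r" "r < s" "0 < lam" "mean C (nu C r) = lam" "mean C (nu C s) = lam"
  shows False
proof -
  let ?G = "\<lambda>r. \<Sum>n\<le>C. (real n - lam) * r powr (real n - lam) / fact n"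
  have G: "?G x = 0" if "0 < x" "mean C (nu C x) = lam" for x
  proof -
    have "?G x = (\<Sum>n\<le>C. (real n - lam) * (x ^ n / fact n)) * x powr (- lam)"
      unfolding sum_distrib_right
      using that by (intro sum.cong) (simp_all add: powr_diff powr_realpow powr_minus divide_inverse)
    with that show ?thesis by (simp add: mean_nu_eq_iff)
  qed
  have summand: "(real n - lam) * r powr (real n - lam) / fact n
      \<le> (real n - lam) * s powr (real n - lam) / fact n" for n
  proof (cases "real n \<ge> lam")
    case True
    then show ?thesis using assms
      by (intro divide_right_mono mult_left_mono powr_mono2) auto
  next
    case False
    then have "s powr (real n - lam) \<le> r powr (real n - lam)"
      using assms by (intro powr_mono2') auto
    then show ?thesis using False
      by (intro divide_right_mono mult_left_mono_neg) auto
  qed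
  \<comment> \<open>Strictness comes from the term \<open>n = 0\<close>, whose coefficient and
    exponent are both \<open>- lam\<close>, a negative number.\<close>
  have "?G r < ?G s"
  proof (rule sum_strict_mono_ex1)
    have "s powr (- lam) < r powr (- lam)"
      using assms by (intro powr_less_mono2_neg) auto
    then have "(real 0 - lam) * r powr (real 0 - lam) / fact 0
        < (real 0 - lam) * s powr (real 0 - lam) / fact 0"
      using assms by (auto simp: mult_less_cancel_left)
    then show "\<exists>a\<in>{..C}. (real a - lam) * r powr (real a - lam) / fact a
        < (real a - lam) * s powr (real a - lam) / fact a"
      by (intro bexI[of _ 0]) auto
  qed (use summand in auto)
  with G[of r] G[of s] assms show False by simp
qed

text \<open>After clearing the normalisation, this is the intermediate value theorem for a
  polynomial that equals \<open>- lam\<close> at 0 and has the positive leading coefficient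
  \<open>(real C - lam) / fact C\<close>.\<close>

lemma mean_nu_surj:
  assumes "1 \<le> C" "0 < lam" "lam < real C"
  shows "\<exists>r>0. mean C (nu C r) = lam"
proof -
  let ?P = "\<lambda>r. \<Sum>n\<le>C. (real n - lam) * (r ^ n / fact n)"
  \<comment> \<open>For \<open>r \<ge> 1\<close> each of the \<open>C\<close> lower terms is at
    least \<open>- lam * r ^ (C - 1)\<close>; from the second argument of \<open>max\<close> on, the
    top term outweighs them all.\<close>
  define r where "r = max 1 (real C * lam * fact C / (real C - lam))"
  have r1: "1 \<le> r" and r2: "real C * lam * fact C / (real C - lam) \<le> r"
    by (auto simp: r_def)
  have P0: "?P 0 < 0"
  proof -
    have "?P 0 = (\<Sum>n\<le>C. if n = 0 then - lam else 0)"
      by (rule sum.cong) (auto simp: power_0_left)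
    then show ?thesis using assms by simp
  qed
  have "(\<Sum>n<C. - (lam * r ^ (C - 1))) \<le> (\<Sum>n<C. (real n - lam) * (r ^ n / fact n))"
  proof (rule sum_mono)
    fix n assume n: "n \<in> {..<C}"
    have "r ^ n / fact n \<le> r ^ n / 1"
      using r1 by (intro divide_left_mono) auto
    also have "\<dots> \<le> r ^ (C - 1)"
      using n r1 by (simp add: power_increasing)
    finally have "lam * (r ^ n / fact n) \<le> lam * r ^ (C - 1)"
      using assms by (intro mult_left_mono) auto
    moreover have "- lam * (r ^ n / fact n) \<le> (real n - lam) * (r ^ n / fact n)"
      using r1 by (intro mult_right_mono) auto
    ultimately show "- (lam * r ^ (C - 1)) \<le> (real n - lam) * (r ^ n / fact n)" by simp
  qed
  moreover have "?P r = (\<Sum>n<C. (real n - lam) * (r ^ n / fact n)) + (real C - lam) * (r ^ C / fact C)"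
    by (simp add: lessThan_Suc_atMost[symmetric])
  moreover have "r ^ C = r ^ (C - 1) * r"
    using assms by (cases C) auto
  moreover have "real C * lam * r ^ (C - 1) \<le> (real C - lam) * (r ^ (C - 1) * r / fact C)"
  proof -
    have "real C * lam \<le> (real C - lam) * r / fact C"
      using r2 assms by (simp add: field_simps)
    from mult_right_mono[OF this, of "r ^ (C - 1)"] r1 show ?thesis
      by (simp add: field_simps)
  qed
  ultimately have Pr: "0 \<le> ?P r" by simp
  have "\<exists>x\<ge>0. x \<le> r \<and> ?P x = 0"
    by (rule IVT') (use P0 Pr r1 in \<open>auto intro!: continuous_intros\<close>)
  then obtain x where x: "0 \<le> x" "?P x = 0" by auto
  then have "x \<noteq> 0" using P0 by auto
  with x show ?thesis by (auto simp: mean_nu_eq_iff intro!: exI[of _ x])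
qed

lemma
  assumes "1 \<le> C" "0 < lam" "lam < real C"
  shows rho_mean_pos: "0 < rho_mean C lam"
    and rho_mean_unique: "0 < r \<Longrightarrow> mean C (nu C r) = lam \<Longrightarrow> r = rho_mean C lam"
proof -
  have *: "\<exists>!r. 0 < r \<and> mean C (nu C r) = lam"
    using mean_nu_surj[OF assms] mean_nu_inj[OF _ _ assms(2)] by (metis linorder_cases)
  from theI'[OF *] have "0 < rho_mean C lam \<and> mean C (nu C (rho_mean C lam)) = lam"
    unfolding rho_mean_def .
  with * show "0 < rho_mean C lam"
    and "0 < r \<Longrightarrow> mean C (nu C r) = lam \<Longrightarrow> r = rho_mean C lam" by auto
qed

lemma nu_pos: "0 < r \<Longrightarrow> n \<le> C \<Longrightarrow> 0 < nu C r n"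
  unfolding nu_def by (auto intro!: divide_pos_pos sum_pos simp del: divide_divide_eq_left)

text \<open>Detailed balance of the queue with arrival rate \<open>r\<close>.\<close>

lemma nu_Suc: "n < C \<Longrightarrow> real (Suc n) * nu C r (Suc n) = r * nu C r n"
  by (simp add: nu_def divide_simps del: of_nat_Suc)

section \<open>The relative entropy\<close>

text \<open>Derivative of \<open>x * ln (x / v)\<close> on the closed half-line; the value at 0 is
  the limit both of the derivative and of the one-sided difference quotient.\<close>

definition xlnx_partial :: "real \<Rightarrow> real \<Rightarrow> ereal" where
  "xlnx_partial v x = (if x = 0 then - \<infinity> else ereal (ln (x / v) + 1))"

text \<open>At \<open>x = 0\<close> the quotient reduces to \<open>ln (s / v)\<close>, since
  \<open>0 * ln 0 = 0\<close>.\<close>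

lemma xlnx_quotient_tendsto:
  assumes "0 < v" "0 \<le> x"
  shows "((\<lambda>s. ereal ((s * ln (s / v) - x * ln (x / v)) / (s - x))) \<longlongrightarrow> xlnx_partial v x) (at x within {0..})"
proof (cases "x = 0")
  case True
  have "filterlim (\<lambda>s. ln (s / v)) at_bot (at_right 0)"
    using assms by real_asymp
  then have "((\<lambda>s. ereal (ln (s / v))) \<longlongrightarrow> - \<infinity>) (at_right 0)"
    by (simp add: tendsto_MInfty filterlim_at_bot_dense)
  moreover have "\<forall>\<^sub>F s in at_right 0. ereal (ln (s / v)) = ereal ((s * ln (s / v) - x * ln (x / v)) / (s - x))"
    using True by (auto simp: eventually_at_filter)
  ultimately have "((\<lambda>s. ereal ((s * ln (s / v) - x * ln (x / v)) / (s - x))) \<longlongrightarrow> - \<infinity>) (at_right 0)"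
    by (rule Lim_transform_eventually)
  then show ?thesis
    using True by (simp add: xlnx_partial_def at_within_Ici_at_right)
next
  case False
  have "((\<lambda>s. s * ln (s / v)) has_real_derivative ln (x / v) + 1) (at x within {0..})"
    using assms False by (auto intro!: derivative_eq_intros simp: field_simps)
  then show ?thesis
    using False by (simp add: has_field_derivative_iff xlnx_partial_def)
qed

lemma at_within_Ici_neq_bot: "(0::real) \<le> x \<Longrightarrow> at x within {0..} \<noteq> bot"
proof (cases "x = 0")
  case False
  assume "0 \<le> x"
  with False have "at x within {0..} = at x"
    by (intro at_within_interior) simp
  then show ?thesis by simp
qed (simp add: at_within_Ici_at_right)

lemma continuous_on_xlnx_partial:
  assumes "0 < v"
  shows "continuous_on {0..} (xlnx_partial v)"
  unfolding continuous_on_def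
proof
  fix x :: real assume "x \<in> {0..}"
  show "(xlnx_partial v \<longlongrightarrow> xlnx_partial v x) (at x within {0..})"
  proof (cases "x = 0")
    case True
    have "filterlim (\<lambda>s. ln (s / v) + 1) at_bot (at_right 0)"
      using assms by real_asymp
    then have "((\<lambda>s. ereal (ln (s / v) + 1)) \<longlongrightarrow> - \<infinity>) (at_right 0)"
      by (simp add: tendsto_MInfty filterlim_at_bot_dense)
    moreover have "\<forall>\<^sub>F s in at_right 0. ereal (ln (s / v) + 1) = xlnx_partial v s"
      by (auto simp: eventually_at_filter xlnx_partial_def)
    ultimately have "(xlnx_partial v \<longlongrightarrow> - \<infinity>) (at_right 0)"
      by (rule Lim_transform_eventually)
    then show ?thesis
      using True by (simp add: at_within_Ici_at_right) (simp add: xlnx_partial_def)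
  next
    case False
    with \<open>x \<in> {0..}\<close> have "0 < x" by auto
    have "((\<lambda>s. ereal (ln (s / v) + 1)) \<longlongrightarrow> ereal (ln (x / v) + 1)) (at x within {0..})"
      using \<open>0 < x\<close> assms by (intro tendsto_intros) auto
    moreover have "\<forall>\<^sub>F s in at x within {0..}. s \<noteq> 0"
      using False by (intro tendsto_imp_eventually_ne[OF tendsto_ident_at])
    then have "\<forall>\<^sub>F s in at x within {0..}. ereal (ln (s / v) + 1) = xlnx_partial v s"
      by eventually_elim (simp add: xlnx_partial_def)
    ultimately show ?thesis
      unfolding xlnx_partial_def[of v x] if_not_P[OF False] by (rule Lim_transform_eventually)
  qed
qed

lemma continuous_on_xlnx:
  assumes "0 < (v::real)"
  shows "continuous_on {0..} (\<lambda>x. x * ln (x / v))"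
  unfolding continuous_on_def
proof
  fix x :: real assume "x \<in> {0..}"
  show "((\<lambda>x. x * ln (x / v)) \<longlongrightarrow> x * ln (x / v)) (at x within {0..})"
  proof (cases "x = 0")
    case True
    have "((\<lambda>x. x * ln (x / v)) \<longlongrightarrow> 0) (at_right 0)"
      using assms by real_asymp
    then show ?thesis using True by (simp add: at_within_Ici_at_right)
  next
    case False
    then show ?thesis using assms \<open>x \<in> {0..}\<close> by (intro tendsto_intros) auto
  qed
qed

lemma continuous_on_orthant_coordinate:
  assumes "continuous_on {0..} f" "n \<le> C"
  shows "continuous_on (orthant C) (\<lambda>y. f (y n))"
  by (rule continuous_on_compose2[OF assms(1)])
     (use assms in \<open>auto simp: orthant_def intro: continuous_on_subset[OF continuous_on_product_coordinates]\<close>)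

text \<open>The entropy is a sum of functions of one coordinate each, so the other coordinates
  cancel.\<close>

lemma partial_quotient_rel_entropy:
  assumes "n \<le> C"
  shows "partial_quotient (\<lambda>y. rel_entropy C y v) y n s =
    ereal ((s * ln (s / v n) - y n * ln (y n / v n)) / (s - y n))"
proof -
  have *: "rel_entropy C z v = z n * ln (z n / v n) + (\<Sum>k\<in>{..C} - {n}. z k * ln (z k / v k))" for z
    using assms by (simp add: rel_entropy_def sum.remove[of "{..C}" n])
  have "(\<Sum>k\<in>{..C} - {n}. (y(n := s)) k * ln ((y(n := s)) k / v k))
      = (\<Sum>k\<in>{..C} - {n}. y k * ln (y k / v k))"
    by (rule sum.cong) auto
  then show ?thesis
    unfolding partial_quotient_def * by simp
qed

lemma partial_quotient_rel_entropy_tendsto: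
  assumes "n \<le> C" "0 < v n" "y \<in> orthant C"
  shows "(partial_quotient (\<lambda>y. rel_entropy C y v) y n \<longlongrightarrow> xlnx_partial (v n) (y n)) (at (y n) within {0..})"
  unfolding partial_quotient_rel_entropy[OF assms(1)]
  using assms by (intro xlnx_quotient_tendsto) (auto simp: orthant_def)

lemma partial_rel_entropy:
  assumes "n \<le> C" "0 < v n" "y \<in> orthant C"
  shows "partial (\<lambda>y. rel_entropy C y v) n y = xlnx_partial (v n) (y n)"
  unfolding partial_def using assms
  by (intro tendsto_Lim partial_quotient_rel_entropy_tendsto at_within_Ici_neq_bot) (auto simp: orthant_def)

lemma C1_on_orthant_rel_entropy:
  assumes v: "\<And>n. n \<le> C \<Longrightarrow> 0 < v n"
  shows "C1_on_orthant C (\<lambda>y. rel_entropy C y v)"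
  unfolding C1_on_orthant_def
proof (intro conjI allI impI ballI)
  show "continuous_on (orthant C) (\<lambda>y. rel_entropy C y v)"
    unfolding rel_entropy_def using v
    by (intro continuous_on_sum continuous_on_orthant_coordinate[OF continuous_on_xlnx]) auto
next
  fix n y assume "n \<le> C" "y \<in> orthant C"
  then show "(partial_quotient (\<lambda>y. rel_entropy C y v) y n \<longlongrightarrow> partial (\<lambda>y. rel_entropy C y v) n y)
      (at (y n) within {0..})"
    using v[of n] by (simp add: partial_rel_entropy partial_quotient_rel_entropy_tendsto)
next
  fix n y assume "n \<le> C" "y \<in> orthant C" "\<forall>k\<le>C. 0 < y k"
  then show "\<bar>partial (\<lambda>y. rel_entropy C y v) n y\<bar> \<noteq> \<infinity>"
    using v[of n] by (force simp: partial_rel_entropy xlnx_partial_def)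
next
  fix n assume n: "n \<le> C"
  have "continuous_on (orthant C) (\<lambda>y. xlnx_partial (v n) (y n))"
    using n v by (intro continuous_on_orthant_coordinate continuous_on_xlnx_partial) auto
  then show "continuous_on (orthant C) (partial (\<lambda>y. rel_entropy C y v) n)"
    using n v by (simp add: partial_rel_entropy cong: continuous_on_cong)
qed

text \<open>Tangent at \<open>x = v\<close> of a convex function, that is
  \<open>ln u \<le> u - 1\<close> at \<open>u = v / x\<close>. It bounds each entropy term below by
  \<open>- v\<close>.\<close>

lemma xlnx_ge:
  assumes "0 \<le> (x::real)" "0 < v"
  shows "x - v \<le> x * ln (x / v)"
proof (cases "x = 0")
  case False
  with assms have "0 < x" by simp
  have "ln (v / x) \<le> v / x - 1"
    using assms \<open>0 < x\<close> by (intro ln_le_minus_one) auto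
  then have "1 - v / x \<le> ln (x / v)"
    using assms \<open>0 < x\<close> by (simp add: ln_div)
  from mult_left_mono[OF this, of x] \<open>0 < x\<close> show ?thesis
    by (simp add: right_diff_distrib)
qed (use assms in simp)

lemma bdd_below_rel_entropy:
  assumes v: "\<And>n. n \<le> C \<Longrightarrow> 0 < v n"
  shows "bdd_below ((\<lambda>y. rel_entropy C y v) ` orthant C)"
proof (rule bdd_belowI2)
  fix y assume y: "y \<in> orthant C"
  show "(\<Sum>n\<le>C. - v n) \<le> rel_entropy C y v"
    unfolding rel_entropy_def
  proof (rule sum_mono)
    fix n assume "n \<in> {..C}"
    then show "- v n \<le> y n * ln (y n / v n)"
      using xlnx_ge[of "y n" "v n"] v[of n] y by (auto simp: orthant_def)
  qed
qed

section \<open>Dissipation of the entropy along the drift\<close>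

lemma diff_mult_ln_diff:
  assumes "0 < (a::real)" "0 < b"
  shows "(a - b) * (ln b - ln a) \<le> 0" "(a - b) * (ln b - ln a) = 0 \<Longrightarrow> a = b"
proof -
  show "(a - b) * (ln b - ln a) \<le> 0"
    using assms by (cases "a \<le> b") (auto simp: mult_le_0_iff)
  show "(a - b) * (ln b - ln a) = 0 \<Longrightarrow> a = b"
    using assms by auto
qed

text \<open>In the extended reals \<open>- \<infinity>\<close> absorbs everything except
  \<open>\<infinity>\<close>, so one term decides the sum.\<close>

lemma sum_eq_MInfty:
  fixes f :: "'a \<Rightarrow> ereal"
  assumes "finite A" "a \<in> A" "f a = - \<infinity>" "\<And>x. x \<in> A \<Longrightarrow> f x \<noteq> \<infinity>"
  shows "sum f A = - \<infinity>"
proof -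
  have "sum f (A - {a}) \<noteq> \<infinity>"
    using assms by (auto simp: sum_Pinfty)
  then show ?thesis
    using assms by (simp add: sum.remove[of A a])
qed

text \<open>An empty level that receives mass makes the sum \<open>- \<infinity>\<close>. If no
  empty level receives mass, emptiness would spread to all levels and contradict total mass one; so
  \<open>y\<close> is positive and summation by parts applies.\<close>

lemma sum_drift_xlnx_partial:
  assumes C: "1 \<le> C" "0 < lam" "lam < real C" and y: "y \<in> prob_vectors_mean C lam"
    and \<rho>: "0 < \<rho>"
  defines "S \<equiv> \<Sum>n\<le>C. ereal (drift C lam y n) * xlnx_partial (nu C \<rho> n) (y n)"
  shows "S \<le> 0" and "S = 0 \<Longrightarrow> n \<le> C \<Longrightarrow> drift C lam y n = 0"
proof -
  let ?F = "drift C lam y" and ?v = "nu C \<rho>"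
  define r where "r = arrival_rate C lam y"
  have yn: "0 \<le> y n" if "n \<le> C" for n
    using y that by (auto simp: prob_vectors_mean_def prob_vectors_def orthant_def)
  have y1: "(\<Sum>n\<le>C. y n) = 1" and ym: "mean C y = lam"
    using y by (auto simp: prob_vectors_mean_def prob_vectors_def)
  have yC: "y C < 1" using C y by (intro last_less_1)
  have r: "0 < r" using C yC by (simp add: r_def arrival_rate_def)
  have F: "?F n = (if 0 < n then r * y (n - 1) - real n * y n else 0)
    - (if n < C then r * y n - real (Suc n) * y (Suc n) else 0)" if "n \<le> C" for n
    using flow_eq[OF that] by (simp add: drift_eq_flow r_def)
  \<comment> \<open>At an empty level nothing flows out, and \<open>A n\<close> and
    \<open>B n\<close> are the inflows from below and from above.\<close>
  define A where "A n = (if 0 < n then r * y (n - 1) else 0)" for n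
  define B where "B n = (if n < C then real (Suc n) * y (Suc n) else 0)" for n
  have AB: "0 \<le> A n" "0 \<le> B n" if "n \<le> C" for n
    using that r yn[of "n - 1"] yn[of "Suc n"] by (auto simp: A_def B_def simp del: of_nat_Suc)
  have FAB: "?F n = A n + B n" if "n \<le> C" "y n = 0" for n
    using F[OF that(1)] that by (cases "n = C") (simp_all add: A_def B_def)
  have F0: "0 \<le> ?F n" if "n \<le> C" "y n = 0" for n
    using FAB[OF that] AB[OF that(1)] by simp
  have "S \<le> 0 \<and> (S = 0 \<longrightarrow> (\<forall>n\<le>C. ?F n = 0))"
  proof (cases "\<exists>n\<le>C. y n = 0 \<and> ?F n \<noteq> 0")
    case True
    then obtain n where n: "n \<le> C" "y n = 0" "?F n > 0"
      using F0 by fastforce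
    have "S = - \<infinity>"
      unfolding S_def
    proof (rule sum_eq_MInfty)
      show "ereal (?F n) * xlnx_partial (?v n) (y n) = - \<infinity>"
        using n by (simp add: xlnx_partial_def)
    next
      fix k assume "k \<in> {..C}"
      then show "ereal (?F k) * xlnx_partial (?v k) (y k) \<noteq> \<infinity>"
        using F0[of k] by (auto simp: xlnx_partial_def)
    qed (use n in auto)
    then show ?thesis by simp
  next
    case False
    have AB0: "A n = 0" "B n = 0" if "n \<le> C" "y n = 0" for n
      using False FAB[OF that] AB[OF that(1)] that by fastforce+
    \<comment> \<open>A vanishing inflow from below means that the level below is empty too;
      likewise above.\<close>
    have down: "y n = 0" if "y (Suc n) = 0" "Suc n \<le> C" for n
      using AB0(1)[of "Suc n"] that r by (simp add: A_def)
    have up: "y (Suc n) = 0" if "y n = 0" "Suc n \<le> C" for n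
      using AB0(2)[of n] that by (simp add: B_def del: of_nat_Suc)
    have pos: "0 < y n" if "n \<le> C" for n
    proof (rule ccontr)
      assume "\<not> 0 < y n"
      then have "y n = 0" using yn that by force
      from this that have "y 0 = 0"
      proof (induction n)
        case (Suc n)
        then show ?case using down[of n] by simp
      qed
      have "y k = 0" if "k \<le> C" for k
        using that
      proof (induction k)
        case (Suc k)
        then show ?case using up[of k] by simp
      qed (use \<open>y 0 = 0\<close> in simp)
      then show False using y1 by simp
    qed
    define a where "a n = r * y n" for n
    define b where "b n = real (Suc n) * y (Suc n)" for n
    let ?\<phi> = "\<lambda>n. ln (y n / ?v n)"
    have a_pos: "0 < a n" and b_pos: "0 < b n" if "n < C" for n
      using pos[of n] pos[of "Suc n"] r that by (auto simp: a_def b_def simp del: of_nat_Suc)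
    have v: "0 < ?v n" if "n \<le> C" for n
      using nu_pos[OF \<rho> that] .
    \<comment> \<open>By detailed balance of \<open>?v\<close>, the increment of the log density
      ratio is the log ratio of the two opposite fluxes, up to a constant independent of
      \<open>n\<close>.\<close>
    have \<phi>: "?\<phi> (Suc n) - ?\<phi> n = (ln (b n) - ln (a n)) + (ln r - ln \<rho>)" if "n < C" for n
    proof -
      have "ln (real (Suc n) * ?v (Suc n)) = ln (\<rho> * ?v n)"
        using nu_Suc[OF that] by simp
      then have "ln (real (Suc n)) + ln (?v (Suc n)) = ln \<rho> + ln (?v n)"
        using v[of n] v[of "Suc n"] that \<rho> by (simp add: ln_mult del: of_nat_Suc)
      then show ?thesis
        using v[of n] v[of "Suc n"] that r pos[of n] pos[of "Suc n"]
        by (simp add: a_def b_def ln_mult ln_div del: of_nat_Suc)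
    qed
    have "S = ereal (\<Sum>n\<le>C. ?F n * (?\<phi> n + 1))"
      unfolding S_def sum_ereal[symmetric]
    proof (rule sum.cong)
      fix n assume "n \<in> {..C}"
      then show "ereal (?F n) * xlnx_partial (?v n) (y n) = ereal (?F n * (?\<phi> n + 1))"
        using pos[of n] by (simp add: xlnx_partial_def)
    qed simp
    \<comment> \<open>The summand 1 of the derivative disappears by conservation of mass.\<close>
    also have "(\<Sum>n\<le>C. ?F n * (?\<phi> n + 1)) = (\<Sum>n\<le>C. ?F n * ?\<phi> n)"
      by (simp add: distrib_left sum.distrib drift_eq_flow sum_flow)
    also have "\<dots> = (\<Sum>n<C. (a n - b n) * (?\<phi> (Suc n) - ?\<phi> n))"
      by (simp add: drift_eq_flow flow_sum r_def a_def b_def)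
    also have "\<dots> = (\<Sum>n<C. (a n - b n) * (ln (b n) - ln (a n)))
        + (\<Sum>n<C. a n - b n) * (ln r - ln \<rho>)"
      unfolding sum_distrib_right sum.distrib[symmetric]
      by (intro sum.cong refl) (simp only: \<phi> lessThan_iff distrib_left)
    also have "(\<Sum>n<C. a n - b n) = 0"
      unfolding a_def b_def sum_flux using yC by (simp add: y1 ym r_def arrival_rate_def)
    finally have S: "S = ereal (\<Sum>n<C. (a n - b n) * (ln (b n) - ln (a n)))"
      by simp
    have neg: "(a n - b n) * (ln (b n) - ln (a n)) \<le> 0" if "n < C" for n
      using diff_mult_ln_diff(1) a_pos b_pos that by blast
    have "S \<le> 0"
      unfolding S using neg by (auto intro!: sum_nonpos)
    moreover have "\<forall>n\<le>C. ?F n = 0" if "S = 0"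
    proof -
      have "(\<Sum>n<C. - ((a n - b n) * (ln (b n) - ln (a n)))) = 0"
        using that unfolding S by (simp add: sum_negf del: of_nat_Suc)
      then have "(a n - b n) * (ln (b n) - ln (a n)) = 0" if "n < C" for n
        using neg that by (subst (asm) sum_nonneg_eq_0_iff) (auto simp del: of_nat_Suc)
      then have ab: "a n = b n" if "n < C" for n
        using diff_mult_ln_diff(2)[OF a_pos b_pos] that by blast
      show ?thesis
      proof (intro allI impI)
        fix n assume n: "n \<le> C"
        then show "?F n = 0"
          using F[OF n] ab[of n] ab[of "n - 1"] by (cases n) (simp_all add: a_def b_def)
      qed
    qed
    ultimately show ?thesis by blast
  qed
  then show "S \<le> 0" and "S = 0 \<Longrightarrow> n \<le> C \<Longrightarrow> ?F n = 0" by auto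
qed

lemma lyapunov_rel_entropy:
  assumes C: "1 \<le> C" "0 < lam" "lam < real C" and \<rho>: "0 < \<rho>"
  shows "lyapunov C (drift C lam) (prob_vectors_mean C lam) (\<lambda>y. rel_entropy C y (nu C \<rho>))"
proof -
  have eq: "(\<Sum>n\<le>C. ereal (drift C lam y n) * partial (\<lambda>y. rel_entropy C y (nu C \<rho>)) n y) =
      (\<Sum>n\<le>C. ereal (drift C lam y n) * xlnx_partial (nu C \<rho> n) (y n))"
    if "y \<in> prob_vectors_mean C lam" for y
    using that nu_pos[OF \<rho>]
    by (intro sum.cong) (auto simp: partial_rel_entropy prob_vectors_mean_def prob_vectors_def)
  show ?thesis
    unfolding lyapunov_def
  proof (intro conjI ballI impI allI)
    show "C1_on_orthant C (\<lambda>y. rel_entropy C y (nu C \<rho>))"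
      by (rule C1_on_orthant_rel_entropy) (rule nu_pos[OF \<rho>])
    show "bdd_below ((\<lambda>y. rel_entropy C y (nu C \<rho>)) ` orthant C)"
      by (rule bdd_below_rel_entropy) (rule nu_pos[OF \<rho>])
  qed (use sum_drift_xlnx_partial[OF C _ \<rho>] in \<open>auto simp: eq\<close>)
qed

section \<open>Differential equations with a Lipschitz vector field\<close>

text \<open>Integrating factor \<open>exp (- K * s)\<close>; a negative \<open>K\<close> gives
  decay. Derivatives are taken within \<open>J\<close>, so that both \<open>{0..}\<close> and
  \<open>{0..<T}\<close> are covered; the monotonicity argument uses interior points, where they are
  ordinary derivatives.\<close>

lemma gronwall_le:
  fixes f f' :: "real \<Rightarrow> real"
  assumes deriv: "\<And>s. s \<in> {0..t} \<Longrightarrow> (f has_real_derivative f' s) (at s within J)"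
    and J: "{0..t} \<subseteq> J" and t: "0 \<le> t"
    and le: "\<And>s. s \<in> {0..t} \<Longrightarrow> f' s \<le> K * f s"
  shows "f t \<le> f 0 * exp (K * t)"
proof -
  let ?g = "\<lambda>s. f s * exp (- K * s)"
  have g: "(?g has_real_derivative (f' s - K * f s) * exp (- K * s)) (at s within J)" if "s \<in> {0..t}" for s
    by (auto intro!: derivative_eq_intros deriv[OF that] simp: algebra_simps)
  have "?g t \<le> ?g 0"
  proof (rule DERIV_nonpos_imp_decreasing_open[OF t])
    fix s assume s: "0 < s" "s < t"
    have "at s within J = at s"
    proof (rule at_within_interior)
      have "{0<..<t} \<subseteq> interior J"
        by (rule interior_maximal) (use J in auto)
      then show "s \<in> interior J" using s by auto
    qed
    then show "\<exists>y. (?g has_real_derivative y) (at s) \<and> y \<le> 0"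
      using g[of s] le[of s] s by (auto simp: mult_le_0_iff)
  next
    show "continuous_on {0..t} ?g"
      using g J by (intro DERIV_continuous_on) (blast intro: DERIV_subset)
  qed
  then have "f t * exp (- K * t) * exp (K * t) \<le> f 0 * exp (K * t)"
    by (intro mult_right_mono) auto
  then show ?thesis by (simp add: mult.assoc flip: exp_add)
qed

section \<open>Preservation of nonnegativity\<close>

text \<open>Squaring makes the negative part differentiable at 0 as well, so that it can enter
  Gronwall's inequality.\<close>

lemma min_0_sq_has_derivative:
  "((\<lambda>x::real. (min x 0)\<^sup>2) has_real_derivative 2 * min x 0) (at x)"
proof -
  consider "x < 0" | "x > 0" | "x = 0" by linarith
  then show ?thesis
  proof cases
    case 1
    have "((\<lambda>x. x\<^sup>2) has_real_derivative 2 * x) (at x)"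
      by (auto intro!: derivative_eq_intros)
    then have "((\<lambda>x. (min x 0)\<^sup>2) has_real_derivative 2 * x) (at x)"
      by (rule has_field_derivative_transform_within_open[of _ _ _ "{..<0}"]) (use 1 in auto)
    then show ?thesis using 1 by simp
  next
    case 2
    have "((\<lambda>x. 0) has_real_derivative 0) (at x)" by simp
    then have "((\<lambda>x. (min x 0)\<^sup>2) has_real_derivative 0) (at x)"
      by (rule has_field_derivative_transform_within_open[of _ _ _ "{0<..}"]) (use 2 in auto)
    then show ?thesis using 2 by simp
  next
    case 3
    have "((\<lambda>h::real. min h 0) \<longlongrightarrow> min 0 0) (at 0)"
      by (intro tendsto_intros)
    moreover have "\<forall>\<^sub>F h in at 0. min h 0 = (min h 0)\<^sup>2 / (h::real)"
      by (auto simp: eventually_at_filter min_def power2_eq_square)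
    ultimately have "((\<lambda>h::real. (min h 0)\<^sup>2 / h) \<longlongrightarrow> min 0 0) (at 0)"
      by (rule Lim_transform_eventually)
    then show ?thesis using 3 by (simp add: has_field_derivative_iff)
  qed
qed

text \<open>The sum of the squared negative parts starts at 0 and grows at most exponentially, so it
  stays 0.\<close>

lemma nonneg_of_quasi_positive:
  fixes y F :: "real \<Rightarrow> nat \<Rightarrow> real"
  assumes deriv: "\<And>s n. s \<in> {0..t} \<Longrightarrow> n \<le> C \<Longrightarrow> ((\<lambda>s. y s n) has_real_derivative F s n) (at s within J)"
    and J: "{0..t} \<subseteq> J" and t: "0 \<le> t"
    and le: "\<And>s. s \<in> {0..t} \<Longrightarrow>
      (\<Sum>n\<le>C. 2 * min (y s n) 0 * F s n) \<le> K * (\<Sum>n\<le>C. (min (y s n) 0)\<^sup>2)"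
    and init: "\<And>n. n \<le> C \<Longrightarrow> 0 \<le> y 0 n" and n: "n \<le> C"
  shows "0 \<le> y t n"
proof -
  let ?V = "\<lambda>s. \<Sum>n\<le>C. (min (y s n) 0)\<^sup>2"
  have "?V t \<le> ?V 0 * exp (K * t)"
  proof (rule gronwall_le[OF _ J t le])
    fix s assume s: "s \<in> {0..t}"
    have "((\<lambda>s. (min (y s n) 0)\<^sup>2) has_real_derivative 2 * min (y s n) 0 * F s n) (at s within J)"
      if "n \<le> C" for n
      by (rule DERIV_chain2[OF min_0_sq_has_derivative deriv[OF s that]])
    then show "(?V has_real_derivative (\<Sum>n\<le>C. 2 * min (y s n) 0 * F s n)) (at s within J)"
      by (intro DERIV_sum) auto
  qed
  also have "?V 0 = 0" using init by (simp add: min_absorb2)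
  finally have "?V t = 0" by (intro antisym sum_nonneg) auto
  then have "(min (y t n) 0)\<^sup>2 = 0"
    using n by (subst (asm) sum_nonneg_eq_0_iff) auto
  then show ?thesis by (simp add: min_def split: if_splits)
qed

section \<open>Global solutions by Picard iteration\<close>

text \<open>Coordinates beyond \<open>C\<close> are frozen, because the Lipschitz hypothesis below
  concerns only the first \<open>C + 1\<close> of them.\<close>

primrec picard :: "((nat \<Rightarrow> real) \<Rightarrow> nat \<Rightarrow> real) \<Rightarrow> nat \<Rightarrow> (nat \<Rightarrow> real) \<Rightarrow> nat \<Rightarrow> real \<Rightarrow> nat \<Rightarrow> real" where
  "picard F C y0 0 t = y0"
| "picard F C y0 (Suc k) t =
     (\<lambda>n. if n \<le> C then y0 n + integral {0..t} (\<lambda>s. F (picard F C y0 k s) n) else y0 n)"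

context
  fixes F :: "(nat \<Rightarrow> real) \<Rightarrow> nat \<Rightarrow> real" and C :: nat and K :: real
  assumes K: "0 < K"
    and lip: "\<And>x y n. n \<le> C \<Longrightarrow> \<bar>F x n - F y n\<bar> \<le> K * (\<Sum>k\<le>C. \<bar>x k - y k\<bar>)"
begin

lemma lipschitz_field_continuous_on:
  assumes u: "\<And>k. k \<le> C \<Longrightarrow> continuous_on S (\<lambda>s. u s k)" and n: "n \<le> C"
  shows "continuous_on S (\<lambda>s. F (u s) n)"
  unfolding continuous_on_def
proof
  fix x assume x: "x \<in> S"
  have "((\<lambda>s. K * (\<Sum>k\<le>C. \<bar>u s k - u x k\<bar>)) \<longlongrightarrow> K * (\<Sum>k\<le>C. \<bar>u x k - u x k\<bar>)) (at x within S)"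
    using u x by (intro tendsto_intros) (auto simp: continuous_on_def)
  then have "((\<lambda>s. K * (\<Sum>k\<le>C. \<bar>u s k - u x k\<bar>)) \<longlongrightarrow> 0) (at x within S)" by simp
  then have "((\<lambda>s. F (u s) n - F (u x) n) \<longlongrightarrow> 0) (at x within S)"
    by (rule Lim_null_comparison[rotated]) (use lip[OF n] in auto)
  then show "((\<lambda>s. F (u s) n) \<longlongrightarrow> F (u x) n) (at x within S)"
    by (simp add: LIM_zero_iff)
qed

lemma continuous_on_picard: "continuous_on {0..T} (\<lambda>t. picard F C y0 k t n)"
proof (induction k arbitrary: n)
  case (Suc k)
  show ?case
  proof (cases "n \<le> C")
    case True
    have "(\<lambda>s. F (picard F C y0 k s) n) integrable_on {0..T}"
      using lipschitz_field_continuous_on[OF Suc True] by (rule integrable_continuous_real)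
    then show ?thesis using True
      by (auto intro!: continuous_intros indefinite_integral_continuous_1)
  qed simp
qed simp

lemma continuous_on_field_picard:
  "n \<le> C \<Longrightarrow> continuous_on {0..T} (\<lambda>t. F (picard F C y0 k t) n)"
  by (rule lipschitz_field_continuous_on) (rule continuous_on_picard)

text \<open>In the norm weighted by \<open>exp (- L t)\<close>, with this \<open>L\<close>, the iteration contracts by a factor 2.\<close>

lemma picard_diff_le:
  assumes t: "0 \<le> t"
  defines "L \<equiv> 2 * real (Suc C) * K"
  shows "(\<Sum>n\<le>C. \<bar>picard F C y0 (Suc k) t n - picard F C y0 k t n\<bar>)
    \<le> (\<Sum>n\<le>C. \<bar>F y0 n\<bar>) / L * exp (L * t) / 2 ^ k"
  using t
proof (induction k arbitrary: t)
  case 0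
  have L: "0 < L" using K by (simp add: L_def)
  have "(\<Sum>n\<le>C. \<bar>picard F C y0 (Suc 0) t n - picard F C y0 0 t n\<bar>) = (\<Sum>n\<le>C. \<bar>F y0 n\<bar>) * t"
    using 0 by (simp add: abs_mult sum_distrib_left mult.commute)
  also have "\<dots> = (\<Sum>n\<le>C. \<bar>F y0 n\<bar>) / L * (L * t)" using L by simp
  also have "\<dots> \<le> (\<Sum>n\<le>C. \<bar>F y0 n\<bar>) / L * exp (L * t)"
  proof (rule mult_left_mono)
    show "L * t \<le> exp (L * t)"
      using exp_ge_add_one_self[of "L * t"] by linarith
  qed (use L in \<open>auto intro!: divide_nonneg_pos sum_nonneg\<close>)
  finally show ?case by simp
next
  case (Suc k)
  define B where "B = (\<Sum>n\<le>C. \<bar>F y0 n\<bar>) / L"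
  have L: "0 < L" using K by (simp add: L_def)
  have B: "0 \<le> B" using L unfolding B_def by (intro divide_nonneg_pos sum_nonneg) auto
  have ftc: "((\<lambda>s. K * (B * exp (L * s) / 2 ^ k)) has_integral
      (K * (B * exp (L * t) / (L * 2 ^ k)) - K * (B * exp (L * 0) / (L * 2 ^ k)))) {0..t}"
  proof (rule fundamental_theorem_of_calculus[OF Suc.prems])
    fix s assume "s \<in> {0..t}"
    have "((\<lambda>s. K * (B * exp (L * s) / (L * 2 ^ k))) has_real_derivative K * (B * exp (L * s) / 2 ^ k)) (at s within {0..t})"
      using L by (auto intro!: derivative_eq_intros simp: field_simps)
    then show "((\<lambda>s. K * (B * exp (L * s) / (L * 2 ^ k))) has_vector_derivative K * (B * exp (L * s) / 2 ^ k)) (at s within {0..t})"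
      by (simp add: has_real_derivative_iff_has_vector_derivative)
  qed
  have "\<bar>picard F C y0 (Suc (Suc k)) t n - picard F C y0 (Suc k) t n\<bar> \<le> K * (B * exp (L * t) / (L * 2 ^ k))"
    if n: "n \<le> C" for n
  proof -
    let ?f = "\<lambda>k s. F (picard F C y0 k s) n"
    have int: "?f k integrable_on {0..t}" for k
      using continuous_on_field_picard[OF n] by (rule integrable_continuous_real)
    have "picard F C y0 (Suc (Suc k)) t n - picard F C y0 (Suc k) t n
        = integral {0..t} (?f (Suc k)) - integral {0..t} (?f k)"
      by (subst (1 2) picard.simps(2)) (simp add: n)
    also have "\<dots> = integral {0..t} (\<lambda>s. ?f (Suc k) s - ?f k s)"
      by (rule integral_diff[symmetric]) (rule int)+
    finally have "\<bar>picard F C y0 (Suc (Suc k)) t n - picard F C y0 (Suc k) t n\<bar>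
        = norm (integral {0..t} (\<lambda>s. ?f (Suc k) s - ?f k s))" by simp
    also have "\<dots> \<le> integral {0..t} (\<lambda>s. K * (B * exp (L * s) / 2 ^ k))"
    proof (rule integral_norm_bound_integral)
      show "(\<lambda>s. ?f (Suc k) s - ?f k s) integrable_on {0..t}"
        by (intro integrable_diff int)
      show "(\<lambda>s. K * (B * exp (L * s) / 2 ^ k)) integrable_on {0..t}"
        using ftc by blast
      fix s assume "s \<in> {0..t}"
      then have "K * (\<Sum>m\<le>C. \<bar>picard F C y0 (Suc k) s m - picard F C y0 k s m\<bar>) \<le> K * (B * exp (L * s) / 2 ^ k)"
        using Suc.IH[of s] K unfolding B_def by (intro mult_left_mono) auto
      then show "norm (?f (Suc k) s - ?f k s) \<le> K * (B * exp (L * s) / 2 ^ k)"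
        using lip[OF n, of "picard F C y0 (Suc k) s" "picard F C y0 k s"] by simp
    qed
    also have "\<dots> \<le> K * (B * exp (L * t) / (L * 2 ^ k))"
      unfolding integral_unique[OF ftc] using K B L by simp
    finally show ?thesis .
  qed
  then have "(\<Sum>n\<le>C. \<bar>picard F C y0 (Suc (Suc k)) t n - picard F C y0 (Suc k) t n\<bar>)
      \<le> (\<Sum>n\<le>C. K * (B * exp (L * t) / (L * 2 ^ k)))"
    by (intro sum_mono) auto
  also have "\<dots> = real (Suc C) * K / L * (B * exp (L * t) / 2 ^ k)"
    by simp
  \<comment> \<open>Integrating \<open>exp (L * s)\<close> gains \<open>1 / L\<close>, while the
    Lipschitz bound costs \<open>K\<close> in each of \<open>Suc C\<close> coordinates;
    \<open>L\<close> is twice that cost.\<close>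
  also have "real (Suc C) * K / L = 1 / 2"
    using K by (simp add: L_def)
  finally show ?case by (simp add: B_def)
qed

text \<open>The limit is a pointwise telescoping series, so a single \<open>y\<close> serves every
  horizon \<open>T\<close>; on \<open>{0..T}\<close> the contraction provides a geometric
  majorant.\<close>

lemma picard_uniform_limit:
  obtains y where "y 0 = y0"
    "\<And>T n. uniform_limit {0..T} (\<lambda>k t. picard F C y0 k t n) (\<lambda>t. y t n) sequentially"
proof -
  define L where "L = 2 * real (Suc C) * K"
  define B where "B = (\<Sum>n\<le>C. \<bar>F y0 n\<bar>) / L"
  have L: "0 < L" using K by (simp add: L_def)
  have B: "0 \<le> B" using L unfolding B_def by (intro divide_nonneg_pos sum_nonneg) auto
  let ?d = "\<lambda>k t n. picard F C y0 (Suc k) t n - picard F C y0 k t n"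
  define y where "y t n = y0 n + (\<Sum>k. ?d k t n)" for t n
  have beyond: "?d k t n = 0" if "n > C" for k t n
    using that by (cases k) auto
  have tele: "picard F C y0 k t n = y0 n + (\<Sum>i<k. ?d i t n)" for k t n
    by (subst sum_lessThan_telescope) simp
  have "uniform_limit {0..T} (\<lambda>k t. \<Sum>i<k. ?d i t n) (\<lambda>t. \<Sum>i. ?d i t n) sequentially" for T n
  proof (rule Weierstrass_m_test)
    fix k t assume t: "t \<in> {0..T}"
    show "norm (?d k t n) \<le> B * exp (L * T) * (1 / 2) ^ k"
    proof (cases "n \<le> C")
      case True
      then have "\<bar>?d k t n\<bar> \<le> (\<Sum>n\<le>C. \<bar>?d k t n\<bar>)"
        by (intro member_le_sum[of n "{..C}" "\<lambda>n. \<bar>?d k t n\<bar>"]) auto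
      also have "\<dots> \<le> B * exp (L * t) / 2 ^ k"
        unfolding B_def L_def using t by (intro picard_diff_le) auto
      also have "\<dots> \<le> B * exp (L * T) / 2 ^ k"
        using t B L by (intro divide_right_mono mult_left_mono) auto
      finally show ?thesis by (simp add: power_one_over)
    qed (use beyond B in simp)
  next
    show "summable (\<lambda>k. B * exp (L * T) * (1 / 2) ^ k)"
      by (intro summable_mult summable_geometric) simp
  qed
  then have "uniform_limit {0..T} (\<lambda>k t. y0 n + (\<Sum>i<k. ?d i t n)) (\<lambda>t. y0 n + (\<Sum>i. ?d i t n)) sequentially" for T n
    by (intro uniform_limit_intros)
  then have lim: "uniform_limit {0..T} (\<lambda>k t. picard F C y0 k t n) (\<lambda>t. y t n) sequentially" for T n
    by (simp only: tele[symmetric] y_def)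
  have "picard F C y0 k 0 = y0" for k
    by (cases k) auto
  then have "y 0 = y0" by (simp add: fun_eq_iff y_def del: picard.simps)
  from this lim show ?thesis by (rule that)
qed

text \<open>Uniform convergence on bounded intervals passes through \<open>F\<close> and the
  integral, so the limit solves the integral equation, which is then differentiated.\<close>

lemma lipschitz_ode_global_solution:
  obtains y where "y 0 = y0"
    "\<And>t n. 0 \<le> t \<Longrightarrow> n \<le> C \<Longrightarrow> ((\<lambda>s. y s n) has_real_derivative F (y t) n) (at t within {0..})"
proof -
  obtain y where y0: "y 0 = y0"
    and lim: "\<And>T n. uniform_limit {0..T} (\<lambda>k t. picard F C y0 k t n) (\<lambda>t. y t n) sequentially"
    using picard_uniform_limit[of y0] by blast
  have cont: "continuous_on {0..T} (\<lambda>t. y t n)" for T n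
    by (rule uniform_limit_theorem[OF _ lim]) (simp_all add: continuous_on_picard)
  have Fcont: "continuous_on {0..T} (\<lambda>t. F (y t) n)" if "n \<le> C" for T n
    using cont that by (rule lipschitz_field_continuous_on)
  have Flim: "uniform_limit {0..T} (\<lambda>k t. F (picard F C y0 k t) n) (\<lambda>t. F (y t) n) sequentially" if n: "n \<le> C" for T n
  proof (rule uniform_limitI)
    fix e :: real assume "0 < e"
    define e' where "e' = e / (K * real (Suc C))"
    have "0 < e'" using \<open>0 < e\<close> K by (simp add: e'_def)
    have "\<forall>\<^sub>F k in sequentially. \<forall>m\<in>{..C}. \<forall>t\<in>{0..T}. dist (picard F C y0 k t m) (y t m) < e'"
      using uniform_limitD[OF lim \<open>0 < e'\<close>] by (intro eventually_ball_finite) auto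
    then show "\<forall>\<^sub>F k in sequentially. \<forall>t\<in>{0..T}. dist (F (picard F C y0 k t) n) (F (y t) n) < e"
    proof eventually_elim
      case (elim k)
      show ?case
      proof
        fix t assume "t \<in> {0..T}"
        then have "(\<Sum>m\<le>C. \<bar>picard F C y0 k t m - y t m\<bar>) < (\<Sum>m\<le>C. e')"
          using elim by (intro sum_strict_mono) (auto simp: dist_real_def)
        then have "K * (\<Sum>m\<le>C. \<bar>picard F C y0 k t m - y t m\<bar>) < K * (real (Suc C) * e')"
          using K by simp
        also have "K * (real (Suc C) * e') = e" using K by (simp add: e'_def del: of_nat_Suc)
        finally show "dist (F (picard F C y0 k t) n) (F (y t) n) < e"
          using lip[OF n, of "picard F C y0 k t" "y t"] by (simp add: dist_real_def)
      qed
    qed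
  qed
  have integral_eq: "y t n = y0 n + integral {0..t} (\<lambda>s. F (y s) n)" if t: "0 \<le> t" and n: "n \<le> C" for t n
  proof -
    obtain I J where I: "\<And>k. ((\<lambda>s. F (picard F C y0 k s) n) has_integral I k) {0..t}"
      and J: "((\<lambda>s. F (y s) n) has_integral J) {0..t}" and IJ: "I \<longlonglongrightarrow> J"
      by (rule uniform_limit_integral[OF Flim[OF n, of t]]) (use continuous_on_field_picard[OF n] in auto)
    have "(\<lambda>k. picard F C y0 (Suc k) t n) = (\<lambda>k. y0 n + I k)"
      using n I by (auto simp: integral_unique)
    moreover have "(\<lambda>k. y0 n + I k) \<longlonglongrightarrow> y0 n + J"
      by (intro tendsto_intros IJ)
    moreover have "(\<lambda>k. picard F C y0 (Suc k) t n) \<longlonglongrightarrow> y t n"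
      by (rule LIMSEQ_Suc) (rule tendsto_uniform_limitI[OF lim[where T = t]], use t in simp)
    ultimately have "y t n = y0 n + J" by (metis LIMSEQ_unique)
    then show ?thesis using J by (simp add: integral_unique)
  qed
  show ?thesis
  proof (rule that[of y])
    show "y 0 = y0" by (rule y0)
  next
    fix t :: real and n assume t: "0 \<le> t" and n: "n \<le> C"
    \<comment> \<open>The interval ends at \<open>t + 1\<close>, so that \<open>t\<close> is not its
      right end and the derivative agrees with the one within \<open>{0..}\<close>.\<close>
    have "((\<lambda>u. y0 n + integral {0..u} (\<lambda>s. F (y s) n)) has_real_derivative 0 + F (y t) n) (at t within {0..t + 1})"
      by (intro DERIV_add DERIV_const integral_has_real_derivative Fcont n) (use t in auto)
    from this[unfolded add_0_left]
    have "((\<lambda>u. y u n) has_real_derivative F (y t) n) (at t within {0..t + 1})"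
      by (rule has_field_derivative_transform_within[where d = 1]) (use t integral_eq n in auto)
    moreover have "at t within {0..t + 1} = at t within {0..}"
      by (rule at_within_nhd[where S = "{..<t + 1}"]) auto
    ultimately show "((\<lambda>s. y s n) has_real_derivative F (y t) n) (at t within {0..})" by simp
  qed
qed

end

section \<open>Invariance\<close>

definition unit_clip :: "real \<Rightarrow> real" where
  "unit_clip x = max 0 (min 1 x)"

text \<open>Clipped coordinates and a denominator of at least \<open>\<delta>\<close> make the field
  globally Lipschitz. It agrees with the drift where all coordinates lie between 0 and 1 and
  \<open>y C \<le> 1 - \<delta>\<close>.\<close>

definition clipped_flow :: "nat \<Rightarrow> real \<Rightarrow> real \<Rightarrow> (nat \<Rightarrow> real) \<Rightarrow> nat \<Rightarrow> real" where
  "clipped_flow C lam \<delta> y = flow C (lam / max \<delta> (1 - y C)) (\<lambda>n. unit_clip (y n))"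

lemma abs_le_times_sum_cases:
  assumes "\<bar>a\<bar> \<le> (A::real) * S" "\<bar>b\<bar> \<le> A * S" "\<bar>c\<bar> \<le> A * S" "\<bar>d\<bar> \<le> A * S"
    and "0 \<le> A * S"
  shows "\<bar>(if P then a - b else 0) - (if Q then c - d else 0)\<bar> \<le> 4 * A * S"
  using assms by (auto simp: abs_le_iff)

text \<open>The rate is at most \<open>lam / \<delta>\<close> and Lipschitz with constant
  \<open>lam / \<delta>\<^sup>2\<close>, clipped coordinates are at most 1, and service rates are at
  most \<open>C\<close>. The factor 4 counts the terms of one coordinate.\<close>

lemma clipped_flow_lipschitz:
  assumes \<delta>: "0 < \<delta>" and lam: "0 < lam" and m: "m \<le> C"
  shows "\<bar>clipped_flow C lam \<delta> x m - clipped_flow C lam \<delta> y m\<bar>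
    \<le> 4 * (lam / \<delta> + lam / \<delta>\<^sup>2 + real C) * (\<Sum>k\<le>C. \<bar>x k - y k\<bar>)"
proof -
  define S where "S = (\<Sum>k\<le>C. \<bar>x k - y k\<bar>)"
  define A where "A = lam / \<delta> + lam / \<delta>\<^sup>2 + real C"
  define r where "r z = lam / max \<delta> (1 - z C)" for z :: "nat \<Rightarrow> real"
  let ?c = "\<lambda>z n. unit_clip (z n) :: real"
  have S: "\<bar>x k - y k\<bar> \<le> S" if "k \<le> C" for k
    unfolding S_def by (rule member_le_sum) (use that in auto)
  have "0 \<le> S" unfolding S_def by (intro sum_nonneg) auto
  have clip: "\<bar>?c x k - ?c y k\<bar> \<le> S" if "k \<le> C" for k
    using S[OF that] by (auto simp: unit_clip_def abs_le_iff)
  have r_le: "0 \<le> r z" "r z \<le> lam / \<delta>" for z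
    using \<delta> lam by (auto simp: r_def intro!: divide_left_mono)
  have r_lip: "\<bar>r x - r y\<bar> \<le> lam / \<delta>\<^sup>2 * S"
  proof -
    let ?a = "max \<delta> (1 - x C)" and ?b = "max \<delta> (1 - y C)"
    have ab: "0 < ?a" "0 < ?b" "\<delta> \<le> ?a" "\<delta> \<le> ?b" using \<delta> by auto
    have "r x - r y = lam * (?b - ?a) / (?a * ?b)"
      using ab by (simp add: r_def diff_frac_eq right_diff_distrib)
    then have "\<bar>r x - r y\<bar> = lam * \<bar>?b - ?a\<bar> / (?a * ?b)"
      using ab lam by (simp add: abs_mult)
    also have "\<dots> \<le> lam * S / (\<delta> * \<delta>)"
    proof (rule frac_le)
      have "\<bar>?b - ?a\<bar> \<le> S" using S[of C] by (auto simp: abs_le_iff)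
      then show "lam * \<bar>?b - ?a\<bar> \<le> lam * S" using lam by simp
      show "\<delta> * \<delta> \<le> ?a * ?b" using ab \<delta> by (intro mult_mono) auto
    qed (use \<delta> lam \<open>0 \<le> S\<close> in auto)
    finally show ?thesis by (simp add: power2_eq_square)
  qed
  have prod: "\<bar>r x * ?c x k - r y * ?c y k\<bar> \<le> A * S" if "k \<le> C" for k
  proof -
    have "r x * ?c x k - r y * ?c y k = r x * (?c x k - ?c y k) + (r x - r y) * ?c y k"
      by (simp add: algebra_simps)
    then have "\<bar>r x * ?c x k - r y * ?c y k\<bar> \<le> \<bar>r x * (?c x k - ?c y k)\<bar> + \<bar>(r x - r y) * ?c y k\<bar>"
      by simp
    also have "\<dots> \<le> lam / \<delta> * S + lam / \<delta>\<^sup>2 * S * 1"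
      unfolding abs_mult using r_le[of x] r_lip clip[OF that] \<open>0 \<le> S\<close> \<delta> lam
      by (intro add_mono mult_mono) (auto simp: unit_clip_def)
    also have "\<dots> \<le> A * S"
      using \<open>0 \<le> S\<close> by (simp add: A_def algebra_simps)
    finally show ?thesis .
  qed
  have lin: "\<bar>real j * ?c x k - real j * ?c y k\<bar> \<le> A * S" if "k \<le> C" "j \<le> C" for j k
  proof -
    have "\<bar>real j * ?c x k - real j * ?c y k\<bar> = real j * \<bar>?c x k - ?c y k\<bar>"
      by (simp add: abs_mult flip: right_diff_distrib)
    also have "\<dots> \<le> A * S"
      using clip[OF that(1)] that(2) \<delta> lam by (intro mult_mono) (auto simp: A_def add_increasing)
    finally show ?thesis .
  qed
  have "0 \<le> A * S" using \<open>0 \<le> S\<close> \<delta> lam by (auto simp: A_def intro!: mult_nonneg_nonneg add_nonneg_nonneg)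
  have "clipped_flow C lam \<delta> x m - clipped_flow C lam \<delta> y m =
      (if 0 < m then (r x * ?c x (m - 1) - r y * ?c y (m - 1)) - (real m * ?c x m - real m * ?c y m) else 0)
      - (if m < C then (r x * ?c x m - r y * ?c y m) - (real (Suc m) * ?c x (Suc m) - real (Suc m) * ?c y (Suc m)) else 0)"
    unfolding clipped_flow_def flow_eq[OF m] r_def[symmetric] by simp
  also have "\<bar>\<dots>\<bar> \<le> 4 * A * S"
  proof (cases "m < C")
    case True
    then show ?thesis
      using m by (intro abs_le_times_sum_cases prod lin \<open>0 \<le> A * S\<close>) auto
  next
    case False
    \<comment> \<open>\<open>lin\<close> does not reach level \<open>Suc C\<close>; the absent
      branch is written \<open>0 - 0\<close> to reuse the same bound.\<close>
    have "\<bar>(if 0 < m then (r x * ?c x (m - 1) - r y * ?c y (m - 1)) - (real m * ?c x m - real m * ?c y m) else 0)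
        - (if m < C then 0 - 0 else 0)\<bar> \<le> 4 * A * S"
      using m \<open>0 \<le> A * S\<close> by (intro abs_le_times_sum_cases prod lin) auto
    then show ?thesis using False by simp
  qed
  finally show ?thesis by (simp add: A_def S_def)
qed

lemma solution_sum_const:
  fixes y :: "real \<Rightarrow> nat \<Rightarrow> real"
  assumes deriv: "\<And>s n. s \<in> J \<Longrightarrow> n \<le> C \<Longrightarrow> ((\<lambda>s. y s n) has_real_derivative F s n) (at s within J)"
    and "convex J" "0 \<in> J" "t \<in> J" and F: "\<And>s. s \<in> J \<Longrightarrow> (\<Sum>n\<le>C. F s n) = 0"
  shows "(\<Sum>n\<le>C. y t n) = (\<Sum>n\<le>C. y 0 n)"
proof -
  have "((\<lambda>s. \<Sum>n\<le>C. y s n) has_real_derivative 0) (at s within J)" if "s \<in> J" for s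
  proof -
    have "((\<lambda>s. \<Sum>n\<le>C. y s n) has_real_derivative (\<Sum>n\<le>C. F s n)) (at s within J)"
      using deriv[OF that] by (intro DERIV_sum) auto
    then show ?thesis using F[OF that] by simp
  qed
  then have "\<exists>c. \<forall>s\<in>J. (\<Sum>n\<le>C. y s n) = c"
    by (intro has_field_derivative_zero_constant \<open>convex J\<close>) auto
  then show ?thesis using \<open>0 \<in> J\<close> \<open>t \<in> J\<close> by auto
qed

lemma mean_has_derivative:
  fixes y :: "real \<Rightarrow> nat \<Rightarrow> real"
  assumes "\<And>n. n \<le> C \<Longrightarrow> ((\<lambda>s. y s n) has_real_derivative flow C r (y s) n) (at s within J)"
    and "(\<Sum>n\<le>C. y s n) = 1"
  shows "((\<lambda>s. mean C (y s)) has_real_derivative r * (1 - y s C) - mean C (y s)) (at s within J)"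
proof -
  have "((\<lambda>s. mean C (y s)) has_real_derivative (\<Sum>n\<le>C. real n * flow C r (y s) n)) (at s within J)"
    unfolding mean_def using assms(1) by (intro DERIV_sum DERIV_cmult) auto
  also have "(\<Sum>n\<le>C. real n * flow C r (y s) n) = r * (1 - y s C) - mean C (y s)"
    using sum_flow_mean[of C r "y s"] assms(2) by (simp add: mult.commute)
  finally show ?thesis .
qed

text \<open>The truncation never acts: coordinates stay nonnegative with sum 1, hence at most 1, and
  the mean stays at most \<open>lam\<close>, hence the last coordinate at most
  \<open>lam / C = 1 - \<delta>\<close>.\<close>

lemma solution_exists:
  assumes C: "1 \<le> C" "0 < lam" "lam < real C" and y0: "y0 \<in> prob_vectors_mean C lam"
  shows "\<exists>y. y 0 = y0 \<and> solution_on C (drift_dom C) (drift C lam) {0..} y"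
proof -
  define \<delta> where "\<delta> = 1 - lam / real C"
  have \<delta>: "0 < \<delta>" using C by (simp add: \<delta>_def)
  let ?K = "4 * (lam / \<delta> + lam / \<delta>\<^sup>2 + real C)"
  have K: "0 < ?K" using C \<delta> by (simp add: add_pos_pos)
  obtain u where u0: "u 0 = y0"
    and u: "\<And>t n. 0 \<le> t \<Longrightarrow> n \<le> C \<Longrightarrow>
      ((\<lambda>s. u s n) has_real_derivative clipped_flow C lam \<delta> (u t) n) (at t within {0..})"
    using lipschitz_ode_global_solution[OF K, of C "clipped_flow C lam \<delta>" y0]
      clipped_flow_lipschitz[OF \<delta> C(2)] by blast
  have y0': "\<And>n. n \<le> C \<Longrightarrow> 0 \<le> y0 n" "(\<Sum>n\<le>C. y0 n) = 1" "mean C y0 = lam" "\<And>n. n > C \<Longrightarrow> y0 n = 0"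
    using y0 by (auto simp: prob_vectors_mean_def prob_vectors_def orthant_def)
  let ?r = "\<lambda>t. lam / max \<delta> (1 - u t C)"
  have r: "0 < ?r t" for t using C \<delta> by (simp add: less_max_iff_disj)
  have nonneg: "0 \<le> u t n" if "0 \<le> t" "n \<le> C" for t n
  proof (rule nonneg_of_quasi_positive[where J = "{0..}" and y = u
        and F = "\<lambda>s. clipped_flow C lam \<delta> (u s)" and K = 0])
    fix s assume "s \<in> {0..t}"
    \<comment> \<open>A negative coordinate is clipped to 0, so it has no outflow and nonnegative
      velocity; this allows \<open>K = 0\<close>.\<close>
    have "2 * min (u s n) 0 * clipped_flow C lam \<delta> (u s) n \<le> 0" if n: "n \<le> C" for n
    proof (cases "0 \<le> u s n")
      case False
      define q where "q = ?r s"
      have q: "0 < q" using r[of s] by (simp only: q_def)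
      have "0 \<le> unit_clip x" for x by (simp add: unit_clip_def)
      then have c: "0 \<le> q * unit_clip (u s k)" "0 \<le> real j * unit_clip (u s k)" for j k
        using q by simp_all
      have "unit_clip (u s n) = 0" using False by (simp add: unit_clip_def)
      then have "0 \<le> flow C q (\<lambda>n. unit_clip (u s n)) n"
        unfolding flow_eq[OF n] using c(1)[of "n - 1"] c(2)[of "Suc n" "Suc n"]
        by (cases n) (simp_all del: of_nat_Suc)
      then have "0 \<le> clipped_flow C lam \<delta> (u s) n"
        by (simp only: clipped_flow_def q_def)
      then show ?thesis using False by (simp add: mult_le_0_iff)
    qed simp
    then show "(\<Sum>n\<le>C. 2 * min (u s n) 0 * clipped_flow C lam \<delta> (u s) n) \<le> 0 * (\<Sum>n\<le>C. (min (u s n) 0)\<^sup>2)"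
      unfolding mult_zero_left by (intro sum_nonpos) auto
  qed (use that u u0 y0' in auto)
  have sum1: "(\<Sum>n\<le>C. u t n) = 1" if "0 \<le> t" for t
    using solution_sum_const[of "{0..}" C u "\<lambda>t. clipped_flow C lam \<delta> (u t)" t] u that u0 y0'(2)
    by (simp add: clipped_flow_def sum_flow)
  have le1: "u t n \<le> 1" if "0 \<le> t" "n \<le> C" for t n
    using member_le_sum[of n "{..C}" "u t"] that nonneg[OF that(1)] sum1[OF that(1)] by auto
  have unclip: "clipped_flow C lam \<delta> (u t) n = flow C (?r t) (u t) n" if "0 \<le> t" for t n
    unfolding clipped_flow_def flow_def
    using nonneg[OF that] le1[OF that] by (intro sum.cong refl) (simp add: unit_clip_def)
  have mean_le: "mean C (u t) \<le> lam" if t: "0 \<le> t" for t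
  proof -
    \<comment> \<open>Truncation enlarges the denominator, so only
      \<open>?r s * (1 - u s C) \<le> lam\<close> holds; the resulting upper bound on the mean is
      what controls \<open>u t C\<close>.\<close>
    have "mean C (u t) - lam \<le> (mean C (u 0) - lam) * exp (- 1 * t)"
    proof (rule gronwall_le[where J = "{0..}"])
      fix s assume "s \<in> {0..t}"
      then have s: "0 \<le> s" by simp
      have "((\<lambda>s. mean C (u s)) has_real_derivative ?r s * (1 - u s C) - mean C (u s)) (at s within {0..})"
        by (rule mean_has_derivative) (use s u unclip sum1 in auto)
      then show "((\<lambda>s. mean C (u s) - lam) has_real_derivative ?r s * (1 - u s C) - mean C (u s)) (at s within {0..})"
        by (auto intro!: derivative_eq_intros)
      have "?r s * (1 - u s C) \<le> lam"
        using C \<delta> le1[OF s, of C] by (subst times_divide_eq_left, subst pos_divide_le_eq) (auto simp: less_max_iff_disj)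
      then show "?r s * (1 - u s C) - mean C (u s) \<le> - 1 * (mean C (u s) - lam)" by simp
    qed (use t in auto)
    then show ?thesis using u0 y0'(3) by simp
  qed
  have last: "u t C \<le> 1 - \<delta>" if "0 \<le> t" for t
    using last_le_of_mean[OF C(1) nonneg[OF that] mean_le[OF that]] by (simp add: \<delta>_def)
  \<comment> \<open>The solution theorem is silent beyond \<open>C\<close>, where
    \<open>drift_dom C\<close> requires zeros.\<close>
  define y where "y t n = (if n \<le> C then u t n else 0)" for t n
  have flow_y: "flow C r' (y t) n = flow C r' (u t) n" for r' t n
    unfolding flow_def y_def by (intro sum.cong) auto
  have "solution_on C (drift_dom C) (drift C lam) {0..} y"
    unfolding solution_on_def
  proof (intro ballI conjI allI impI)
    fix t :: real assume "t \<in> {0..}"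
    then have t: "0 \<le> t" by simp
    show "y t \<in> drift_dom C"
      using last[OF t] \<delta> by (auto simp: drift_dom_def y_def)
    fix n assume n: "n \<le> C"
    have "?r t = arrival_rate C lam (y t)"
      using last[OF t] by (simp add: arrival_rate_def y_def max_absorb2)
    then have "drift C lam (y t) n = clipped_flow C lam \<delta> (u t) n"
      by (simp add: drift_eq_flow flow_y unclip[OF t])
    then show "((\<lambda>s. y s n) has_real_derivative drift C lam (y t) n) (at t within {0..})"
      using u[OF t n] n by (simp add: y_def)
  qed
  moreover have "y 0 = y0" using u0 y0'(4) by (auto simp: y_def fun_eq_iff)
  ultimately show ?thesis by blast
qed

text \<open>Negative neighbours can push a coordinate further down, but
  \<open>v n * x k \<le> v n * v k\<close> for the negative part \<open>v\<close>, and
  \<open>2 * (v n * v k)\<close> is at most the sum of the two squares. Outflow terms have the good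
  sign.\<close>

lemma flow_quasi_positive:
  assumes r: "0 \<le> r" "r \<le> R" and n: "n \<le> C"
  shows "2 * min (x n) 0 * flow C r x n \<le> 2 * (R + real C) * (\<Sum>k\<le>C. (min (x k) 0)\<^sup>2)"
proof -
  define v where "v k = min (x k) 0" for k
  define V where "V = (\<Sum>k\<le>C. (v k)\<^sup>2)"
  have V: "(v k)\<^sup>2 \<le> V" if "k \<le> C" for k
    unfolding V_def by (rule member_le_sum) (use that in auto)
  have "0 \<le> V" unfolding V_def by (intro sum_nonneg) auto
  have vx: "2 * (v n * x k) \<le> 2 * V" if "k \<le> C" for k
  proof -
    have "v n * x k \<le> v n * v k"
      by (intro mult_left_mono_neg) (auto simp: v_def)
    moreover have "0 \<le> (v n - v k)\<^sup>2" by simp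
    then have "2 * (v n * v k) \<le> (v n)\<^sup>2 + (v k)\<^sup>2" by (simp add: power2_diff)
    ultimately show ?thesis using V[OF n] V[OF that] by linarith
  qed
  have vv: "v n * x n = (v n)\<^sup>2" by (simp add: v_def min_def power2_eq_square)
  have weighted: "c * (2 * (v n * x k)) \<le> D * (2 * V)" if "k \<le> C" "0 \<le> c" "c \<le> D" for c D k
  proof -
    have "c * (2 * (v n * x k)) \<le> c * (2 * V)" using vx that by (intro mult_left_mono) auto
    also have "\<dots> \<le> D * (2 * V)" using that \<open>0 \<le> V\<close> by (intro mult_right_mono) auto
    finally show ?thesis .
  qed
  have "2 * v n * flow C r x n =
    (if 0 < n then r * (2 * (v n * x (n - 1))) else 0) + (if n < C then real (Suc n) * (2 * (v n * x (Suc n))) else 0)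
    - 2 * ((if 0 < n then real n else 0) + (if n < C then r else 0)) * (v n)\<^sup>2"
    unfolding flow_eq[OF n] vv[symmetric] by (simp add: algebra_simps del: of_nat_Suc)
  also have "\<dots> \<le> R * (2 * V) + real C * (2 * V) - 0"
  proof (intro diff_mono add_mono)
    show "(if 0 < n then r * (2 * (v n * x (n - 1))) else 0) \<le> R * (2 * V)"
      using weighted[of "n - 1" r R] r n \<open>0 \<le> V\<close> by auto
    show "(if n < C then real (Suc n) * (2 * (v n * x (Suc n))) else 0) \<le> real C * (2 * V)"
      using weighted[of "Suc n" "real (Suc n)" "real C"] \<open>0 \<le> V\<close> by (auto simp del: of_nat_Suc)
    show "0 \<le> 2 * ((if 0 < n then real n else 0) + (if n < C then r else 0)) * (v n)\<^sup>2"
      using r by auto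
  qed
  finally show ?thesis by (simp add: v_def V_def algebra_simps)
qed

text \<open>No sign is known beforehand. By continuity the solution cannot cross
  \<open>y C = 1\<close>, which the domain excludes. On the compact \<open>{0..t}\<close> the rate
  is then bounded, which gives nonnegativity; mass and mean obey linear equations of their
  own.\<close>

lemma solution_stays:
  assumes C: "1 \<le> C" "0 < lam" "lam < real C" and init: "y 0 \<in> prob_vectors_mean C lam"
    and sol: "solution_on C (drift_dom C) (drift C lam) {0..<T} y" and t: "t \<in> {0..<T}"
  shows "y t \<in> prob_vectors_mean C lam"
proof -
  let ?J = "{0..<T}"
  have tJ: "{0..t} \<subseteq> ?J" "0 \<le> t" "0 \<in> ?J" using t by auto
  have dom: "y s C \<noteq> 1" "\<And>n. n > C \<Longrightarrow> y s n = 0" if "s \<in> ?J" for s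
    using sol that by (auto simp: solution_on_def drift_dom_def)
  define r where "r s = arrival_rate C lam (y s)" for s
  have deriv: "((\<lambda>s. y s n) has_real_derivative flow C (r s) (y s) n) (at s within ?J)" if "s \<in> ?J" "n \<le> C" for s n
    using sol that by (simp add: solution_on_def drift_eq_flow r_def)
  have y0: "\<And>n. n \<le> C \<Longrightarrow> 0 \<le> y 0 n" "(\<Sum>n\<le>C. y 0 n) = 1" "mean C (y 0) = lam"
    using init by (auto simp: prob_vectors_mean_def prob_vectors_def orthant_def)
  have contJ: "continuous_on ?J (\<lambda>s. y s C)"
    by (rule DERIV_continuous_on[OF deriv]) auto
  have lt1: "y s C < 1" if s: "s \<in> ?J" for s
  proof (rule ccontr)
    assume "\<not> y s C < 1"
    moreover have "y 0 C < 1" by (rule last_less_1[OF C(1,3) init])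
    moreover have "continuous_on {0..s} (\<lambda>s. y s C)"
      by (rule continuous_on_subset[OF contJ]) (use s in auto)
    ultimately have "\<exists>x\<ge>0. x \<le> s \<and> y x C = 1"
      using s by (intro IVT') auto
    then show False using dom(1) s by fastforce
  qed
  have sum1: "(\<Sum>n\<le>C. y s n) = 1" if "s \<in> ?J" for s
    using solution_sum_const[of ?J C y "\<lambda>s. flow C (r s) (y s)" s] deriv that y0(2) tJ(3)
    by (simp add: sum_flow)
  have cont: "continuous_on {0..t} (\<lambda>s. y s C)"
    by (rule continuous_on_subset[OF contJ tJ(1)])
  \<comment> \<open>The maximum over \<open>{0..t}\<close> is attained, hence below 1; this makes
    the Gronwall constant uniform in \<open>s\<close>.\<close>
  obtain s0 where s0: "s0 \<in> {0..t}" "\<And>s. s \<in> {0..t} \<Longrightarrow> y s C \<le> y s0 C"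
    using continuous_attains_sup[OF compact_Icc _ cont] tJ(2) by auto
  define R where "R = lam / (1 - y s0 C)"
  have r: "0 \<le> r s" "r s \<le> R" if "s \<in> {0..t}" for s
    using s0(2)[OF that] lt1[of s] lt1[of s0] s0(1) tJ(1) that C
    by (auto simp: r_def R_def arrival_rate_def intro!: divide_left_mono mult_pos_pos)
  have nonneg: "0 \<le> y t n" if "n \<le> C" for n
  proof (rule nonneg_of_quasi_positive[where J = ?J and y = y and F = "\<lambda>s. flow C (r s) (y s)"
        and K = "real (Suc C) * (2 * (R + real C))"])
    fix s assume s: "s \<in> {0..t}"
    have "(\<Sum>n\<le>C. 2 * min (y s n) 0 * flow C (r s) (y s) n)
        \<le> (\<Sum>n\<le>C. 2 * (R + real C) * (\<Sum>k\<le>C. (min (y s k) 0)\<^sup>2))"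
      by (intro sum_mono flow_quasi_positive r[OF s]) auto
    also have "\<dots> = real (Suc C) * (2 * (R + real C)) * (\<Sum>k\<le>C. (min (y s k) 0)\<^sup>2)"
      by simp
    finally show "(\<Sum>n\<le>C. 2 * min (y s n) 0 * flow C (r s) (y s) n)
        \<le> real (Suc C) * (2 * (R + real C)) * (\<Sum>k\<le>C. (min (y s k) 0)\<^sup>2)" .
  qed (use deriv tJ y0(1) that in auto)
  have mean_deriv: "((\<lambda>s. mean C (y s)) has_real_derivative lam - mean C (y s)) (at s within ?J)" if s: "s \<in> ?J" for s
  proof -
    have "((\<lambda>s. mean C (y s)) has_real_derivative r s * (1 - y s C) - mean C (y s)) (at s within ?J)"
      by (rule mean_has_derivative) (use s deriv sum1 in auto)
    moreover have "r s * (1 - y s C) = lam" using lt1[OF s] by (simp add: r_def arrival_rate_def)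
    ultimately show ?thesis by simp
  qed
  \<comment> \<open>The two signs \<open>\<sigma> = 1\<close> and \<open>\<sigma> = - 1\<close> turn
    the one-sided inequality into an equality.\<close>
  have "\<sigma> * (mean C (y t) - lam) \<le> \<sigma> * (mean C (y 0) - lam) * exp (- 1 * t)" for \<sigma>
  proof (rule gronwall_le[where J = ?J])
    fix s assume "s \<in> {0..t}"
    then have s: "s \<in> ?J" using tJ by auto
    show "((\<lambda>s. \<sigma> * (mean C (y s) - lam)) has_real_derivative \<sigma> * (lam - mean C (y s))) (at s within ?J)"
      using mean_deriv[OF s] by (auto intro!: derivative_eq_intros)
    show "\<sigma> * (lam - mean C (y s)) \<le> - 1 * (\<sigma> * (mean C (y s) - lam))"
      by (simp add: algebra_simps)
  qed (use tJ in auto)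
  from this[of 1] this[of "- 1"] have "mean C (y t) = lam" using y0(3) by simp
  then show ?thesis
    using nonneg sum1[OF t] dom(2)[OF t] by (auto simp: prob_vectors_mean_def prob_vectors_def orthant_def)
qed

lemma invariant_set_drift:
  assumes "1 \<le> C" "0 < lam" "lam < real C"
  shows "invariant_set C (drift_dom C) (drift C lam) (prob_vectors_mean C lam)"
  unfolding invariant_set_def
proof (intro conjI ballI allI impI)
  show "\<exists>y. y 0 = y0 \<and> solution_on C (drift_dom C) (drift C lam) {0..} y"
    if "y0 \<in> prob_vectors_mean C lam" for y0
    using that by (rule solution_exists[OF assms])
qed (rule solution_stays[OF assms])

section \<open>Reversibility and lumpability of the network\<close>

lemma sum_occupancy:
  assumes "\<And>c. c < M \<Longrightarrow> z c < N"
  shows "(\<Sum>i<N. occupancy M z i) = M"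
proof -
  have "(\<Sum>i<N. \<Sum>c\<in>{c\<in>{..<M}. z c = i}. 1) = (\<Sum>c<M. 1::nat)"
    using assms by (intro sum.group) auto
  then show ?thesis by (simp add: occupancy_def)
qed

lemma occupancy_update:
  assumes "c < M" "z c \<noteq> j"
  shows "occupancy M (z(c := j)) i =
    (if i = j then Suc (occupancy M z i) else if i = z c then occupancy M z i - 1 else occupancy M z i)"
proof -
  have fin: "finite {d. d < M \<and> z d = k}" for k by simp
  have "{d. d < M \<and> (z(c := j)) d = j} = insert c {d. d < M \<and> z d = j}"
    using assms by auto
  moreover have "{d. d < M \<and> (z(c := j)) d = z c} = {d. d < M \<and> z d = z c} - {c}"
    using assms by auto
  moreover have "{d. d < M \<and> (z(c := j)) d = i} = {d. d < M \<and> z d = i}" if "i \<noteq> j" "i \<noteq> z c"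
    using that by auto
  ultimately show ?thesis
    using assms by (auto simp: occupancy_def card_Diff_singleton)
qed

lemma occupancy_pos: "c < M \<Longrightarrow> 0 < occupancy M z (z c)"
  unfolding occupancy_def by (subst card_gt_0_iff) auto

lemma finite_configs: "finite (configs C N M)"
  by (rule finite_subset[of _ "{..<M} \<rightarrow>\<^sub>E {..<N}"]) (auto simp: configs_def intro: finite_PiE)

lemma configs_lt: "z \<in> configs C N M \<Longrightarrow> c < M \<Longrightarrow> z c < N"
  by (auto simp: configs_def PiE_def Pi_def)

lemma configs_occupancy_le: "z \<in> configs C N M \<Longrightarrow> i < N \<Longrightarrow> occupancy M z i \<le> C"
  by (auto simp: configs_def)

lemma sum_occupancy_configs: "z \<in> configs C N M \<Longrightarrow> (\<Sum>i<N. occupancy M z i) = M"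
  by (rule sum_occupancy) (rule configs_lt)

lemma finite_targets [simp]: "finite (targets C N M z c)"
  by (simp add: targets_def)

lemma configs_update:
  assumes "z \<in> configs C N M" "c < M" "j \<in> targets C N M z c"
  shows "z(c := j) \<in> configs C N M"
  unfolding configs_def
proof (intro CollectI conjI allI impI)
  show "z(c := j) \<in> {..<M} \<rightarrow>\<^sub>E {..<N}"
    using assms by (auto simp: configs_def targets_def PiE_def Pi_def extensional_def)
  fix i assume "i < N"
  then have "occupancy M z i \<le> C"
    using configs_occupancy_le[OF assms(1)] by simp
  then show "occupancy M (z(c := j)) i \<le> C"
    using assms by (auto simp: occupancy_update targets_def)
qed

text \<open>
  The nodes available to customer \<open>c\<close>, together with his own, are those that are not saturated once
  he is removed; this set is not affected by his jump.
\<close>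

lemma targets_update:
  assumes "z \<in> configs C N M" "c < M" "j \<in> targets C N M z c"
  shows "targets C N M (z(c := j)) c = insert (z c) (targets C N M z c) - {j}"
proof -
  have "occupancy M z (z c) \<le> C" "0 < occupancy M z (z c)" "z c < N"
    using configs_lt[OF assms(1,2)] configs_occupancy_le[OF assms(1)] occupancy_pos[OF assms(2)] by blast+
  then show ?thesis
    using assms by (auto simp: targets_def occupancy_update split: if_splits)
qed

lemma card_targets_update:
  assumes "z \<in> configs C N M" "c < M" "j \<in> targets C N M z c"
  shows "card (targets C N M (z(c := j)) c) = card (targets C N M z c)"
proof -
  have "z c \<notin> targets C N M z c" by (simp add: targets_def)
  then show ?thesis
    using assms by (simp add: targets_update card_Diff_singleton)
qed

text \<open>The reversal \<open>?r\<close> is an involution on admissible jumps. The weight is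
  arbitrary: it carries jump rates for the Dirichlet form, and occupancy conditions for the balance
  between two nodes.\<close>

lemma sum_jumps_reverse:
  fixes \<Psi> :: "nat \<Rightarrow> (nat \<Rightarrow> nat) \<Rightarrow> (nat \<Rightarrow> nat) \<Rightarrow> real"
  shows "(\<Sum>z\<in>configs C N M. \<Sum>c<M. \<Sum>j\<in>targets C N M z c. \<Psi> c z (z(c := j))) =
    (\<Sum>z\<in>configs C N M. \<Sum>c<M. \<Sum>j\<in>targets C N M z c. \<Psi> c (z(c := j)) z)"
proof -
  let ?A = "SIGMA z:configs C N M. SIGMA c:{..<M}. targets C N M z c"
  let ?r = "\<lambda>(z, c, j). (z(c := j), c, z c)"
  have r: "?r x \<in> ?A" "?r (?r x) = x" if "x \<in> ?A" for x
    using that by (auto simp: configs_update targets_update) (auto simp: targets_def)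
  have sig: "(\<Sum>z\<in>configs C N M. \<Sum>c<M. \<Sum>j\<in>targets C N M z c. g z c j) = (\<Sum>(z, c, j)\<in>?A. g z c j)"
    for g :: "(nat \<Rightarrow> nat) \<Rightarrow> nat \<Rightarrow> nat \<Rightarrow> real"
    by (simp add: sum.Sigma finite_configs)
  have "(\<Sum>x\<in>?A. case x of (z, c, j) \<Rightarrow> \<Psi> c z (z(c := j))) =
      (\<Sum>x\<in>?A. case x of (z, c, j) \<Rightarrow> \<Psi> c (z(c := j)) z)"
  proof (rule sum.reindex_bij_witness[of _ ?r ?r])
    fix x assume "x \<in> ?A"
    then show "(case ?r x of (z, c, j) \<Rightarrow> \<Psi> c (z(c := j)) z) = (case x of (z, c, j) \<Rightarrow> \<Psi> c z (z(c := j)))"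
      by auto
  qed (use r in blast)+
  then show ?thesis
    unfolding sig .
qed

text \<open>Average of the sum and its reversal, the rates at both ends of a jump being equal. With
  \<open>f = 1\<close> this yields invariance of the uniform law, with \<open>f = g\<close> the
  Dirichlet form.\<close>

lemma generator_dirichlet:
  "(\<Sum>z\<in>configs C N M. f z * generator C N M g z) =
    - (\<Sum>z\<in>configs C N M. \<Sum>c<M. \<Sum>j\<in>targets C N M z c.
        (f (z(c := j)) - f z) * (g (z(c := j)) - g z) / real (card (targets C N M z c))) / 2"
proof -
  let ?S = "\<lambda>\<Psi>. \<Sum>z\<in>configs C N M. \<Sum>c<M. \<Sum>j\<in>targets C N M z c. \<Psi> c z (z(c := j)) :: real"
  let ?k = "\<lambda>c z. real (card (targets C N M z c))"
  have "(\<Sum>z\<in>configs C N M. f z * generator C N M g z) = ?S (\<lambda>c z z'. f z * (g z' - g z) / ?k c z)"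
    by (simp add: generator_def sum_distrib_left)
  moreover have "?S (\<lambda>c z z'. f z * (g z' - g z) / ?k c z) = ?S (\<lambda>c z z'. f z' * (g z - g z') / ?k c z)"
    unfolding sum_jumps_reverse[of "\<lambda>c z z'. f z * (g z' - g z) / ?k c z"]
    by (intro sum.cong refl) (simp add: card_targets_update)
  moreover have "?S (\<lambda>c z z'. (f z' - f z) * (g z' - g z) / ?k c z) =
      - (?S (\<lambda>c z z'. f z * (g z' - g z) / ?k c z) + ?S (\<lambda>c z z'. f z' * (g z - g z') / ?k c z))"
    unfolding sum.distrib[symmetric] sum_negf[symmetric] add_divide_distrib[symmetric]
      minus_divide_left
    by (intro sum.cong refl arg_cong2[where f = "(/)"]) (simp add: algebra_simps)
  ultimately show ?thesis by simp
qed

lemma sum_generator: "(\<Sum>z\<in>configs C N M. generator C N M g z) = 0"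
  using generator_dirichlet[of "\<lambda>_. 1" C N M g] by simp

section \<open>The semigroup as a power series in time\<close>

text \<open>Each of the \<open>M\<close> customers contributes an average of differences bounded by
  \<open>2 * B\<close>, or nothing if he has no target.\<close>

lemma abs_generator_le:
  assumes B: "\<And>z. z \<in> configs C N M \<Longrightarrow> \<bar>f z\<bar> \<le> B" and z: "z \<in> configs C N M"
  shows "\<bar>generator C N M f z\<bar> \<le> 2 * real M * B"
proof -
  have "0 \<le> B" using B[OF z] by simp
  have "\<bar>generator C N M f z\<bar> \<le> (\<Sum>c<M. \<bar>\<Sum>j\<in>targets C N M z c. (f (z(c := j)) - f z) / real (card (targets C N M z c))\<bar>)"
    unfolding generator_def by (rule sum_abs)
  also have "\<dots> \<le> (\<Sum>c<M. 2 * B)"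
  proof (rule sum_mono)
    fix c assume c: "c \<in> {..<M}"
    let ?T = "targets C N M z c"
    have "\<bar>\<Sum>j\<in>?T. (f (z(c := j)) - f z) / real (card ?T)\<bar> \<le> (\<Sum>j\<in>?T. \<bar>(f (z(c := j)) - f z) / real (card ?T)\<bar>)"
      by (rule sum_abs)
    also have "\<dots> \<le> (\<Sum>j\<in>?T. 2 * B / real (card ?T))"
    proof (rule sum_mono)
      fix j assume "j \<in> ?T"
      then have "\<bar>f (z(c := j)) - f z\<bar> \<le> 2 * B"
        using B[OF configs_update[OF z, of c j]] B[OF z] c by auto
      then show "\<bar>(f (z(c := j)) - f z) / real (card ?T)\<bar> \<le> 2 * B / real (card ?T)"
        by (simp add: divide_right_mono)
    qed
    also have "\<dots> \<le> 2 * B"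
      using \<open>0 \<le> B\<close> by (cases "card ?T = 0") auto
    finally show "\<bar>\<Sum>j\<in>?T. (f (z(c := j)) - f z) / real (card ?T)\<bar> \<le> 2 * B" .
  qed
  finally show ?thesis by (simp add: mult_ac)
qed

lemma abs_generator_pow_le:
  assumes "\<And>z. z \<in> configs C N M \<Longrightarrow> \<bar>f z\<bar> \<le> B" "z \<in> configs C N M"
  shows "\<bar>(generator C N M ^^ k) f z\<bar> \<le> (2 * real M) ^ k * B"
  using assms(2)
proof (induction k arbitrary: z)
  case (Suc k)
  then show ?case
    using abs_generator_le[of C N M "(generator C N M ^^ k) f" "(2 * real M) ^ k * B" z]
    by (simp add: mult_ac)
qed (use assms in simp)

lemma summable_semigroup:
  assumes "z \<in> configs C N M"
  shows "summable (\<lambda>k. t ^ k / fact k * (generator C N M ^^ k) f z)"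
proof -
  define B where "B = (\<Sum>z\<in>configs C N M. \<bar>f z\<bar>)"
  have B: "\<bar>f z\<bar> \<le> B" if "z \<in> configs C N M" for z
    unfolding B_def by (rule member_le_sum) (use that finite_configs in auto)
  show ?thesis
  proof (rule summable_comparison_test)
    show "summable (\<lambda>k. B * (inverse (fact k) * (\<bar>t\<bar> * (2 * real M)) ^ k))"
      by (intro summable_mult summable_exp)
    have "norm (t ^ k / fact k * (generator C N M ^^ k) f z) \<le> B * (inverse (fact k) * (\<bar>t\<bar> * (2 * real M)) ^ k)" for k
    proof -
      have "\<bar>t\<bar> ^ k / fact k * \<bar>(generator C N M ^^ k) f z\<bar> \<le> \<bar>t\<bar> ^ k / fact k * ((2 * real M) ^ k * B)"
        by (intro mult_left_mono abs_generator_pow_le B assms) auto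
      then show ?thesis
        by (simp add: abs_mult power_abs power_mult_distrib divide_inverse mult_ac)
    qed
    then show "\<exists>n0. \<forall>k\<ge>n0. norm (t ^ k / fact k * (generator C N M ^^ k) f z) \<le> B * (inverse (fact k) * (\<bar>t\<bar> * (2 * real M)) ^ k)"
      by blast
  qed
qed

text \<open>Written as a power series in \<open>t\<close>, so that the derivative at 0 can be read
  off the coefficients.\<close>

lemma weighted_sum_semigroup_sums:
  "(\<lambda>k. (\<Sum>z\<in>configs C N M. w z * (generator C N M ^^ k) f z) / fact k * t ^ k) sums
     (\<Sum>z\<in>configs C N M. w z * transition_semigroup C N M t f z)"
proof -
  have "(\<lambda>k. \<Sum>z\<in>configs C N M. w z * (t ^ k / fact k * (generator C N M ^^ k) f z)) sums
     (\<Sum>z\<in>configs C N M. w z * transition_semigroup C N M t f z)"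
    unfolding transition_semigroup_def
    by (intro sums_sum sums_mult summable_sums summable_semigroup)
  moreover have "(\<Sum>z\<in>configs C N M. w z * (t ^ k / fact k * (generator C N M ^^ k) f z)) =
      (\<Sum>z\<in>configs C N M. w z * (generator C N M ^^ k) f z) / fact k * t ^ k" for k
    unfolding sum_divide_distrib sum_distrib_right by (intro sum.cong refl) simp
  ultimately show ?thesis by simp
qed

lemma sum_semigroup:
  "(\<Sum>z\<in>configs C N M. transition_semigroup C N M t f z) = (\<Sum>z\<in>configs C N M. f z)"
proof -
  have "(\<lambda>k. (\<Sum>z\<in>configs C N M. (generator C N M ^^ k) f z) / fact k * t ^ k) =
      (\<lambda>k. if k = 0 then \<Sum>z\<in>configs C N M. f z else 0)"
  proof
    fix k
    show "(\<Sum>z\<in>configs C N M. (generator C N M ^^ k) f z) / fact k * t ^ k =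
      (if k = 0 then \<Sum>z\<in>configs C N M. f z else 0)"
      by (cases k) (simp_all add: sum_generator)
  qed
  with weighted_sum_semigroup_sums[where w = "\<lambda>_. 1" and C = C and N = N and M = M and f = f and t = t]
  have "(\<lambda>k. if k = 0 then \<Sum>z\<in>configs C N M. f z else 0) sums
      (\<Sum>z\<in>configs C N M. transition_semigroup C N M t f z)"
    by simp
  moreover have "(\<lambda>k. if k = 0 then \<Sum>z\<in>configs C N M. f z else 0) sums (\<Sum>z\<in>configs C N M. f z)"
    using sums_If_finite_set[of "{0::nat}" "\<lambda>_. \<Sum>z\<in>configs C N M. f z"] by simp
  ultimately show ?thesis by (rule sums_unique2)
qed

text \<open>The sum is the coefficient of \<open>t\<close> in a power series that is constant for
  \<open>t \<ge> 0\<close>. Since constancy is known only there, the right derivative at 0 is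
  used.\<close>

lemma weighted_sum_generator_eq_0:
  assumes const: "\<And>t. 0 \<le> t \<Longrightarrow> (\<Sum>z\<in>configs C N M. w z * transition_semigroup C N M t f z) = c"
  shows "(\<Sum>z\<in>configs C N M. w z * generator C N M f z) = 0"
proof -
  define a where "a k = (\<Sum>z\<in>configs C N M. w z * (generator C N M ^^ k) f z) / fact k" for k
  define \<phi> where "\<phi> t = (\<Sum>k. a k * t ^ k)" for t
  have sums: "(\<lambda>k. a k * t ^ k) sums (\<Sum>z\<in>configs C N M. w z * transition_semigroup C N M t f z)" for t
    using weighted_sum_semigroup_sums unfolding a_def .
  then have "\<phi> t = c" if "0 \<le> t" for t
    using const[OF that] unfolding \<phi>_def by (metis sums_unique)
  have "(\<phi> has_field_derivative (\<Sum>k. diffs a k * 0 ^ k)) (at 0)"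
    unfolding \<phi>_def by (rule termdiffs_strong_converges_everywhere) (use sums sums_summable in blast)
  also have "(\<Sum>k. diffs a k * 0 ^ k) = a 1"
    by (subst powser_zero) (simp add: diffs_def)
  finally have "((\<lambda>t. (\<phi> t - \<phi> 0) / (t - 0)) \<longlongrightarrow> a 1) (at_right 0)"
    by (auto simp: has_field_derivative_iff intro: tendsto_mono[OF at_le])
  moreover have "((\<lambda>t. (\<phi> t - \<phi> 0) / (t - 0)) \<longlongrightarrow> 0) (at_right 0)"
    by (rule tendsto_eventually) (auto simp: eventually_at_filter \<open>\<And>t. 0 \<le> t \<Longrightarrow> \<phi> t = c\<close>)
  ultimately have "a 1 = 0"
    by (rule tendsto_unique[OF trivial_limit_at_right_real])
  then show ?thesis by (simp add: a_def)
qed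

section \<open>Relabelling of nodes and customers\<close>

lemma
  assumes \<sigma>: "\<sigma> permutes {..<N}" and \<tau>: "\<tau> permutes {..<M}"
    and rel: "\<And>c. c < M \<Longrightarrow> z' (\<tau> c) = \<sigma> (z c)"
  shows occupancy_relabel: "occupancy M z' (\<sigma> i) = occupancy M z i"
    and empirical_relabel: "empirical N M z' = empirical N M z"
proof -
  have occ: "occupancy M z' (\<sigma> i) = occupancy M z i" for i
  proof -
    have "bij_betw \<tau> {c. c < M \<and> z c = i} {c. c < M \<and> z' c = \<sigma> i}"
    proof (rule bij_betw_imageI)
      show "inj_on \<tau> {c. c < M \<and> z c = i}"
        using permutes_inj_on[OF \<tau>] .
      show "\<tau> ` {c. c < M \<and> z c = i} = {c. c < M \<and> z' c = \<sigma> i}"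
      proof (intro equalityI subsetI)
        fix d assume d: "d \<in> {c. c < M \<and> z' c = \<sigma> i}"
        then have "d \<in> \<tau> ` {..<M}" using permutes_image[OF \<tau>] by auto
        then obtain c where "c < M" "d = \<tau> c" by auto
        moreover from this d have "\<sigma> (z c) = \<sigma> i" using rel by auto
        then have "z c = i" using permutes_inj[OF \<sigma>] by (auto dest: injD)
        ultimately show "d \<in> \<tau> ` {c. c < M \<and> z c = i}" by auto
      qed (use rel permutes_in_image[OF \<tau>] in auto)
    qed
    from bij_betw_same_card[OF this] show ?thesis
      by (simp add: occupancy_def)
  qed
  then show "occupancy M z' (\<sigma> i) = occupancy M z i" .
  show "empirical N M z' = empirical N M z"
  proof
    fix n
    have "(\<Sum>i<N. of_bool (occupancy M z' i = n) :: real) = (\<Sum>i<N. of_bool (occupancy M z' (\<sigma> i) = n))"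
      by (rule sum.reindex_bij_betw[OF permutes_imp_bij[OF \<sigma>], symmetric])
    then show "empirical N M z' n = empirical N M z n"
      by (simp add: empirical_def occ)
  qed
qed

lemma image_mset_mset_set_eqI:
  assumes "finite A" "\<And>b. card {a\<in>A. f a = b} = card {a\<in>A. g a = b}"
  shows "image_mset f (mset_set A) = image_mset g (mset_set A)"
proof (rule multiset_eqI)
  fix b
  show "count (image_mset f (mset_set A)) b = count (image_mset g (mset_set A)) b"
    using assms by (simp add: count_image_mset_eq_card_vimage)
qed

text \<open>Two matchings by equal multisets: \<open>\<sigma>\<close> pairs nodes of equal
  occupancy; then each node has as many customers under \<open>\<sigma> \<circ> z\<close> as under
  \<open>z'\<close>, which gives \<open>\<tau>\<close>.\<close>

lemma ex_relabel:
  assumes z: "z \<in> configs C N M" and z': "z' \<in> configs C N M"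
    and eq: "empirical N M z = empirical N M z'"
  obtains \<sigma> \<tau> where "\<sigma> permutes {..<N}" "\<tau> permutes {..<M}" "\<And>c. c < M \<Longrightarrow> z' (\<tau> c) = \<sigma> (z c)"
proof -
  have "card {i\<in>{..<N}. occupancy M z i = n} = card {i\<in>{..<N}. occupancy M z' i = n}" for n
  proof (cases "N = 0")
    case False
    then have "(\<Sum>i<N. of_bool (occupancy M z i = n)) = (\<Sum>i<N. of_bool (occupancy M z' i = n) :: real)"
      using fun_cong[OF eq, of n] by (simp add: empirical_def)
    then show ?thesis by (simp add: Int_def conj_commute)
  qed simp
  then have "image_mset (occupancy M z) (mset_set {..<N}) = image_mset (occupancy M z') (mset_set {..<N})"
    by (intro image_mset_mset_set_eqI) auto
  then obtain \<sigma> where \<sigma>: "\<sigma> permutes {..<N}" "\<forall>i\<in>{..<N}. occupancy M z i = occupancy M z' (\<sigma> i)"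
    by (rule image_mset_eq_implies_permutes[rotated]) auto
  have "card {c\<in>{..<M}. \<sigma> (z c) = b} = card {c\<in>{..<M}. z' c = b}" for b
  proof (cases "b < N")
    case True
    then obtain i where i: "i < N" "b = \<sigma> i"
      using permutes_image[OF \<sigma>(1)] by (metis imageE lessThan_iff)
    then have "card {c\<in>{..<M}. \<sigma> (z c) = b} = occupancy M z i"
      using permutes_inj[OF \<sigma>(1)] by (simp add: occupancy_def inj_eq)
    also have "\<dots> = occupancy M z' b" using \<sigma>(2) i by simp
    finally show ?thesis by (simp add: occupancy_def)
  next
    case False
    then have "{c\<in>{..<M}. \<sigma> (z c) = b} = {}" "{c\<in>{..<M}. z' c = b} = {}"
      using configs_lt[OF z] configs_lt[OF z'] permutes_in_image[OF \<sigma>(1)] by fastforce+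
    then show ?thesis by (simp only: card.empty)
  qed
  then have "image_mset (\<lambda>c. \<sigma> (z c)) (mset_set {..<M}) = image_mset z' (mset_set {..<M})"
    by (intro image_mset_mset_set_eqI) auto
  then obtain \<tau> where "\<tau> permutes {..<M}" "\<forall>c\<in>{..<M}. \<sigma> (z c) = z' (\<tau> c)"
    by (rule image_mset_eq_implies_permutes[rotated]) auto
  with \<sigma> show ?thesis by (intro that[of \<sigma> \<tau>]) auto
qed

definition lumped :: "nat \<Rightarrow> nat \<Rightarrow> nat \<Rightarrow> ((nat \<Rightarrow> nat) \<Rightarrow> 'a) \<Rightarrow> bool" where
  "lumped C N M f \<longleftrightarrow> (\<forall>z\<in>configs C N M. \<forall>z'\<in>configs C N M. empirical N M z = empirical N M z' \<longrightarrow> f z = f z')"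

text \<open>A relabelling turns the jump of \<open>c\<close> to \<open>j\<close> from
  \<open>z\<close> into the jump of \<open>\<tau> c\<close> to \<open>\<sigma> j\<close> from
  \<open>z'\<close>, with equally many targets and the same empirical measure afterwards.\<close>

lemma lumped_generator:
  assumes "lumped C N M f"
  shows "lumped C N M (generator C N M f)"
  unfolding lumped_def
proof (intro ballI impI)
  fix z z' assume z: "z \<in> configs C N M" and z': "z' \<in> configs C N M"
    and eq: "empirical N M z = empirical N M z'"
  then obtain \<sigma> \<tau> where \<sigma>: "\<sigma> permutes {..<N}" and \<tau>: "\<tau> permutes {..<M}"
    and rel: "\<And>c. c < M \<Longrightarrow> z' (\<tau> c) = \<sigma> (z c)"
    by (rule ex_relabel) (rule that)
  note inj = permutes_inj[OF \<sigma>] permutes_inj[OF \<tau>]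
  have occ: "occupancy M z' (\<sigma> i) = occupancy M z i" for i
    by (rule occupancy_relabel[OF \<sigma> \<tau>]) (rule rel)
  have targets: "targets C N M z' (\<tau> c) = \<sigma> ` targets C N M z c" if c: "c < M" for c
  proof (intro equalityI subsetI)
    fix j assume j: "j \<in> targets C N M z' (\<tau> c)"
    then have "j \<in> \<sigma> ` {..<N}" using permutes_image[OF \<sigma>] by (auto simp: targets_def)
    then obtain i where "i < N" "j = \<sigma> i" by auto
    with j have "i \<in> targets C N M z c"
      using occ[of i] rel[OF c] by (auto simp: targets_def)
    with \<open>j = \<sigma> i\<close> show "j \<in> \<sigma> ` targets C N M z c" by auto
  next
    fix j assume "j \<in> \<sigma> ` targets C N M z c"
    then show "j \<in> targets C N M z' (\<tau> c)"
      using permutes_in_image[OF \<sigma>] occ rel[OF c] inj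
      by (auto simp: targets_def inj_eq)
  qed
  have "generator C N M f z' =
    (\<Sum>c<M. \<Sum>j\<in>targets C N M z' (\<tau> c). (f (z'(\<tau> c := j)) - f z') / real (card (targets C N M z' (\<tau> c))))"
    unfolding generator_def
    by (rule sum.reindex_bij_betw[OF permutes_imp_bij[OF \<tau>], symmetric])
  also have "\<dots> = generator C N M f z"
    unfolding generator_def
  proof (rule sum.cong)
    fix c assume "c \<in> {..<M}"
    then have c: "c < M" by simp
    have inj_on: "inj_on \<sigma> A" for A using permutes_inj_on[OF \<sigma>] .
    have "(\<Sum>j\<in>targets C N M z' (\<tau> c). (f (z'(\<tau> c := j)) - f z') / real (card (targets C N M z' (\<tau> c)))) =
        (\<Sum>j\<in>targets C N M z c. (f (z'(\<tau> c := \<sigma> j)) - f z') / real (card (targets C N M z c)))"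
      unfolding targets[OF c] by (simp add: sum.reindex[OF inj_on] card_image[OF inj_on])
    also have "\<dots> = (\<Sum>j\<in>targets C N M z c. (f (z(c := j)) - f z) / real (card (targets C N M z c)))"
    proof (rule sum.cong)
      fix j assume j: "j \<in> targets C N M z c"
      have "z'(\<tau> c := \<sigma> j) \<in> configs C N M"
        using j targets[OF c] permutes_in_image[OF \<tau>] c by (intro configs_update z') auto
      moreover have "z(c := j) \<in> configs C N M"
        using j c by (intro configs_update z)
      moreover have "empirical N M (z'(\<tau> c := \<sigma> j)) = empirical N M (z(c := j))"
        by (rule empirical_relabel[OF \<sigma> \<tau>]) (use rel inj in \<open>auto simp: inj_eq\<close>)
      ultimately have "f (z'(\<tau> c := \<sigma> j)) = f (z(c := j))" "f z' = f z"
        using assms z z' eq unfolding lumped_def by metis+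
      then show "(f (z'(\<tau> c := \<sigma> j)) - f z') / real (card (targets C N M z c)) =
        (f (z(c := j)) - f z) / real (card (targets C N M z c))" by simp
    qed simp
    finally show "(\<Sum>j\<in>targets C N M z' (\<tau> c). (f (z'(\<tau> c := j)) - f z') / real (card (targets C N M z' (\<tau> c)))) =
       (\<Sum>j\<in>targets C N M z c. (f (z(c := j)) - f z) / real (card (targets C N M z c)))" .
  qed simp
  finally show "generator C N M f z = generator C N M f z'" by simp
qed

lemma lumped_semigroup:
  assumes "lumped C N M f"
  shows "lumped C N M (transition_semigroup C N M t f)"
proof -
  have "lumped C N M ((generator C N M ^^ k) f)" for k
    by (induction k) (use assms lumped_generator in auto)
  then have "(generator C N M ^^ k) f z = (generator C N M ^^ k) f z'"
    if "z \<in> configs C N M" "z' \<in> configs C N M" "empirical N M z = empirical N M z'" for k z z'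
    using that unfolding lumped_def by blast
  from this[of z z' for z z'] show ?thesis
    unfolding lumped_def transition_semigroup_def
    by (intro ballI impI suminf_cong arg_cong2[where f = "(*)"] refl)
qed

text \<open>Irreducibility up to relabelling. While some node holds more customers than in
  \<open>z'\<close>, another holds fewer, hence is unsaturated, and a jump between them lowers the
  total excess. Without excess the occupancies agree and \<open>lumped\<close> concludes.\<close>

lemma const_of_jump_invariant:
  assumes lumped: "lumped C N M f"
    and jump: "\<And>z c j. z \<in> configs C N M \<Longrightarrow> c < M \<Longrightarrow> j \<in> targets C N M z c \<Longrightarrow> f (z(c := j)) = f z"
    and z: "z \<in> configs C N M" and z': "z' \<in> configs C N M"
  shows "f z = f z'"
  using z
\<comment> \<open>Truncated subtraction keeps only the excess over \<open>z'\<close>.\<close>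
proof (induction "\<Sum>i<N. occupancy M z i - occupancy M z' i" arbitrary: z rule: less_induct)
  case less
  show ?case
  proof (cases "\<exists>i<N. occupancy M z' i < occupancy M z i")
    case True
    then obtain i where i: "i < N" "occupancy M z' i < occupancy M z i" by auto
    have "\<exists>j<N. occupancy M z j < occupancy M z' j"
    proof (rule ccontr)
      assume "\<not> ?thesis"
      then have "\<forall>j\<in>{..<N}. occupancy M z' j \<le> occupancy M z j" by force
      then have "(\<Sum>i<N. occupancy M z' i) < (\<Sum>i<N. occupancy M z i)"
        using i by (intro sum_strict_mono_ex1) auto
      then show False using sum_occupancy_configs less.prems z' by force
    qed
    then obtain j where j: "j < N" "occupancy M z j < occupancy M z' j" by auto
    from i have "{c. c < M \<and> z c = i} \<noteq> {}"
      unfolding occupancy_def by (metis card.empty not_less0)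
    then obtain c where c: "c < M" "z c = i" by auto
    have "i \<noteq> j" using i j by auto
    have jT: "j \<in> targets C N M z c"
      using j c \<open>i \<noteq> j\<close> configs_occupancy_le[OF z' j(1)] by (auto simp: targets_def)
    have "(\<Sum>k<N. occupancy M (z(c := j)) k - occupancy M z' k) < (\<Sum>k<N. occupancy M z k - occupancy M z' k)"
    proof (rule sum_strict_mono_ex1)
      show "\<exists>k\<in>{..<N}. occupancy M (z(c := j)) k - occupancy M z' k < occupancy M z k - occupancy M z' k"
        using i c \<open>i \<noteq> j\<close> by (intro bexI[of _ i]) (auto simp: occupancy_update)
    qed (use c j \<open>i \<noteq> j\<close> in \<open>auto simp: occupancy_update\<close>)
    then have "f (z(c := j)) = f z'"
      by (rule less.hyps) (use configs_update less.prems c jT in auto)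
    then show ?thesis using jump[OF less.prems c(1) jT] by simp
  next
    case False
    have "occupancy M z i = occupancy M z' i" if "i < N" for i
    proof (rule ccontr)
      assume "occupancy M z i \<noteq> occupancy M z' i"
      moreover have le: "\<forall>j\<in>{..<N}. occupancy M z j \<le> occupancy M z' j" using False by force
      ultimately have "occupancy M z i < occupancy M z' i" using that by force
      then have "(\<Sum>i<N. occupancy M z i) < (\<Sum>i<N. occupancy M z' i)"
        using le that by (intro sum_strict_mono_ex1) auto
      then show False using sum_occupancy_configs less.prems z' by force
    qed
    then have "empirical N M z = empirical N M z'"
      by (auto simp: empirical_def)
    then show ?thesis using lumped less.prems z' unfolding lumped_def by blast
  qed
qed

section \<open>The stationary distribution\<close>

text \<open>Serves twice: to place customers at nodes with given occupancies, and to assign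
  occupancies to nodes with given frequencies.\<close>

lemma ex_fun_with_fibres:
  fixes k :: "'b \<Rightarrow> nat"
  assumes "finite B" "finite A" "(\<Sum>b\<in>B. k b) = card A"
  obtains f where "f \<in> A \<rightarrow> B" "\<And>b. b \<in> B \<Longrightarrow> card {a\<in>A. f a = b} = k b"
proof -
  have "\<exists>f. f \<in> A \<rightarrow> B \<and> (\<forall>b\<in>B. card {a\<in>A. f a = b} = k b)"
    using assms
  proof (induction B arbitrary: A rule: finite_induct)
    case (insert b B)
    then have "k b \<le> card A" by simp
    then obtain A1 where A1: "A1 \<subseteq> A" "card A1 = k b" "finite A1"
      by (rule obtain_subset_with_card_n)
    have "(\<Sum>b\<in>B. k b) = card (A - A1)"
      using insert A1 by (simp add: card_Diff_subset)
    with insert obtain f where f: "f \<in> A - A1 \<rightarrow> B" "\<forall>b\<in>B. card {a\<in>A - A1. f a = b} = k b"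
      by blast
    let ?f = "\<lambda>a. if a \<in> A1 then b else f a"
    have "{a\<in>A. ?f a = b} = A1"
      using f(1) A1 insert.hyps by auto
    moreover have "{a\<in>A. ?f a = b'} = {a\<in>A - A1. f a = b'}" if "b' \<in> B" for b'
      using that A1 insert.hyps by auto
    ultimately have "\<forall>b'\<in>insert b B. card {a\<in>A. ?f a = b'} = k b'"
      using f(2) A1(2) by simp
    moreover have "?f \<in> A \<rightarrow> insert b B" using f(1) by (auto simp: Pi_def)
    ultimately show ?case by blast
  qed auto
  with that show ?thesis by blast
qed

lemma ex_config_with_occupancy:
  assumes "(\<Sum>i<N. x i) = M" "\<And>i. i < N \<Longrightarrow> x i \<le> C"
  obtains z where "z \<in> configs C N M" "\<And>i. i < N \<Longrightarrow> occupancy M z i = x i"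
proof -
  obtain f where f: "f \<in> {..<M} \<rightarrow> {..<N}" "\<And>i. i \<in> {..<N} \<Longrightarrow> card {c\<in>{..<M}. f c = i} = x i"
    by (rule ex_fun_with_fibres[of "{..<N}" "{..<M}" x]) (use assms in auto)
  define z where "z = restrict f {..<M}"
  have "{c. c < M \<and> z c = i} = {c\<in>{..<M}. f c = i}" for i
    by (auto simp: z_def)
  then have occ: "occupancy M z i = x i" if "i < N" for i
    using f(2) that by (simp add: occupancy_def)
  have "z \<in> {..<M} \<rightarrow>\<^sub>E {..<N}"
    unfolding z_def using f(1) by (auto simp: restrict_PiE_iff)
  with occ assms(2) show ?thesis
    by (intro that[of z]) (auto simp: configs_def)
qed

lemma configs_nonempty:
  assumes "M \<le> N * C"
  shows "configs C N M \<noteq> {}"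
proof -
  have "\<exists>x. (\<Sum>i<N. x i) = M \<and> (\<forall>i<N. x i \<le> C)"
    using assms
  proof (induction N arbitrary: M)
    case (Suc N)
    \<comment> \<open>Greedy filling: the last node takes as many customers as it can.\<close>
    then have "M - min C M \<le> N * C" by auto
    with Suc.IH obtain x where "(\<Sum>i<N. x i) = M - min C M" "\<forall>i<N. x i \<le> C" by blast
    then show ?case
      by (intro exI[of _ "x(N := min C M)"]) (auto simp: less_Suc_eq)
  qed simp
  then obtain x where "(\<Sum>i<N. x i) = M" "\<And>i. i < N \<Longrightarrow> x i \<le> C" by blast
  then obtain z where "z \<in> configs C N M"
    by (rule ex_config_with_occupancy)
  then show ?thesis by auto
qed

lemma sum_count_mult:
  fixes F :: "nat \<Rightarrow> real"
  assumes "\<And>i. i < N \<Longrightarrow> x i \<le> C"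
  shows "(\<Sum>n\<le>C. F n * (\<Sum>i<N. of_bool (x i = n))) = (\<Sum>i<N. F (x i))"
proof -
  have "(\<Sum>n\<le>C. F n * (\<Sum>i<N. of_bool (x i = n))) = (\<Sum>i<N. \<Sum>n\<le>C. F n * of_bool (x i = n))"
    by (subst sum.swap) (simp add: sum_distrib_left)
  also have "\<dots> = (\<Sum>i<N. F (x i))"
  proof (rule sum.cong)
    fix i assume "i \<in> {..<N}"
    then have "(\<Sum>n\<le>C. F n * of_bool (x i = n)) = (\<Sum>n\<le>C. if n = x i then F n else 0)"
      by (intro sum.cong) auto
    then show "(\<Sum>n\<le>C. F n * of_bool (x i = n)) = F (x i)"
      using assms[of i] \<open>i \<in> {..<N}\<close> by simp
  qed simp
  finally show ?thesis .
qed

lemma sum_empirical_mult: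
  assumes "z \<in> configs C N M"
  shows "(\<Sum>n\<le>C. F n * empirical N M z n) = (\<Sum>i<N. F (occupancy M z i)) / real N"
  using sum_count_mult[of N "occupancy M z" C F] configs_occupancy_le[OF assms]
  by (simp add: empirical_def sum_divide_distrib[symmetric])

lemma mean_empirical:
  assumes "z \<in> configs C N M"
  shows "mean C (empirical N M z) = real M / real N"
  using sum_empirical_mult[OF assms, of real] sum_occupancy_configs[OF assms]
  by (simp add: mean_def flip: of_nat_sum)

lemma empirical_in_prob_vectors:
  assumes "z \<in> configs C N M" "1 \<le> N"
  shows "empirical N M z \<in> prob_vectors C"
proof -
  have "empirical N M z n = 0" if "n > C" for n
  proof -
    have "of_bool (occupancy M z i = n) = (0::real)" if "i < N" for i
      using configs_occupancy_le[OF assms(1) that] \<open>n > C\<close> by simp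
    then show ?thesis by (simp add: empirical_def)
  qed
  moreover have "(\<Sum>n\<le>C. empirical N M z n) = 1"
    using sum_empirical_mult[OF assms(1), of "\<lambda>_. 1"] assms by simp
  ultimately show ?thesis
    by (auto simp: prob_vectors_def orthant_def empirical_def intro!: divide_nonneg_nonneg sum_nonneg)
qed

text \<open>From left to right, integrality of \<open>N * y n\<close> provides the frequencies of
  the occupancies, and the mean forces the occupancies to sum to \<open>M\<close>.\<close>

lemma empirical_states_eq:
  assumes "1 \<le> N"
  shows "empirical_states C N M = empirical N M ` configs C N M"
proof (intro equalityI subsetI)
  fix y assume "y \<in> empirical N M ` configs C N M"
  then obtain z where z: "z \<in> configs C N M" "y = empirical N M z" by auto
  moreover have "real N * empirical N M z n \<in> \<nat>" for n
  proof -
    have "real N * empirical N M z n = real (\<Sum>i<N. of_bool (occupancy M z i = n))"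
      using assms by (simp add: empirical_def)
    then show ?thesis by (simp only: of_nat_in_Nats)
  qed
  ultimately show "y \<in> empirical_states C N M"
    using assms by (simp add: empirical_states_def empirical_in_prob_vectors mean_empirical)
next
  fix y assume "y \<in> empirical_states C N M"
  then have y: "y \<in> prob_vectors C" "\<And>n. n \<le> C \<Longrightarrow> real N * y n \<in> \<nat>" "mean C y = real M / real N"
    by (auto simp: empirical_states_def)
  then have "\<forall>n. \<exists>k. n \<le> C \<longrightarrow> real N * y n = real k"
    unfolding Nats_def by blast
  then obtain k where k: "\<And>n. n \<le> C \<Longrightarrow> real N * y n = real (k n)" by metis
  have "real (\<Sum>n\<le>C. k n) = real N * (\<Sum>n\<le>C. y n)"
    by (simp add: sum_distrib_left k)
  also have "\<dots> = real (card {..<N})"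
    using y(1) by (simp add: prob_vectors_def)
  finally have "(\<Sum>n\<le>C. k n) = card {..<N}"
    by (simp only: of_nat_eq_iff)
  then obtain x where x: "x \<in> {..<N} \<rightarrow> {..C}" "\<And>n. n \<in> {..C} \<Longrightarrow> card {i\<in>{..<N}. x i = n} = k n"
    by (rule ex_fun_with_fibres[rotated 2]) auto
  have cnt: "(\<Sum>i<N. of_bool (x i = n)) = real N * y n" if "n \<le> C" for n
    using x(2)[of n] k[OF that] that by (simp add: Int_def)
  have xC: "x i \<le> C" if "i < N" for i using x(1) that by auto
  have "real (\<Sum>i<N. x i) = (\<Sum>i<N. real (x i))" by simp
  also have "\<dots> = (\<Sum>n\<le>C. real n * (\<Sum>i<N. of_bool (x i = n)))"
    by (rule sum_count_mult[symmetric]) (rule xC)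
  also have "\<dots> = real N * mean C y"
    unfolding mean_def sum_distrib_left[where r = "real N"]
    by (intro sum.cong refl) (simp only: cnt atMost_iff mult.left_commute)
  also have "\<dots> = real M" using y(3) assms by simp
  finally have "(\<Sum>i<N. x i) = M" by (simp only: of_nat_eq_iff)
  then obtain z where z: "z \<in> configs C N M" "\<And>i. i < N \<Longrightarrow> occupancy M z i = x i"
    using ex_config_with_occupancy xC by metis
  have "empirical N M z = y"
  proof
    fix n show "empirical N M z n = y n"
    proof (cases "n \<le> C")
      case True
      then show ?thesis using cnt[OF True] z(2) assms by (simp add: empirical_def Int_def cong: conj_cong)
    next
      case False
      then show ?thesis using y(1) empirical_in_prob_vectors[OF z(1) assms]
        by (simp add: prob_vectors_def orthant_def)
    qed
  qed
  with z show "y \<in> empirical N M ` configs C N M" by auto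
qed

section \<open>The unique invariant distribution\<close>

lemma expectation_configs:
  fixes f :: "(nat \<Rightarrow> nat) \<Rightarrow> real"
  assumes "set_pmf \<mu> \<subseteq> configs C N M"
  shows "measure_pmf.expectation \<mu> f = (\<Sum>z\<in>configs C N M. pmf \<mu> z * f z)"
  using assms by (subst integral_measure_pmf[OF finite_configs]) auto

definition uniform_empirical :: "nat \<Rightarrow> nat \<Rightarrow> nat \<Rightarrow> (nat \<Rightarrow> real) pmf" where
  "uniform_empirical C N M = map_pmf (empirical N M) (pmf_of_set (configs C N M))"

lemma expectation_uniform_empirical:
  fixes f :: "(nat \<Rightarrow> real) \<Rightarrow> real"
  assumes "configs C N M \<noteq> {}"
  shows "measure_pmf.expectation (uniform_empirical C N M) f =
    (\<Sum>z\<in>configs C N M. f (empirical N M z)) / real (card (configs C N M))"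
  unfolding uniform_empirical_def integral_map_pmf
  by (rule integral_pmf_of_set[OF assms finite_configs])

lemma lumpedD:
  "lumped C N M f \<Longrightarrow> z \<in> configs C N M \<Longrightarrow> z' \<in> configs C N M \<Longrightarrow>
    empirical N M z = empirical N M z' \<Longrightarrow> f z = f z'"
  unfolding lumped_def by blast

text \<open>By lumpability the expectation depends on \<open>\<mu>\<close> only through its image,
  so \<open>\<mu>\<close> may be replaced by the uniform law, which the semigroup preserves.\<close>

lemma invariant_dist_uniform_empirical:
  assumes ne: "configs C N M \<noteq> {}" and N: "1 \<le> N"
  shows "invariant_dist C N M (uniform_empirical C N M)"
  unfolding invariant_dist_def
proof (intro conjI allI impI)
  show "set_pmf (uniform_empirical C N M) \<subseteq> empirical_states C N M"
    unfolding uniform_empirical_def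
    using set_pmf_of_set[OF ne finite_configs] by (simp add: empirical_states_eq[OF N])
next
  fix \<mu> t y
  assume \<mu>: "set_pmf \<mu> \<subseteq> configs C N M" "map_pmf (empirical N M) \<mu> = uniform_empirical C N M"
    and "0 \<le> (t::real)"
  let ?e = "empirical N M"
  let ?f = "\<lambda>z. of_bool (?e z = y) :: real"
  let ?P = "transition_semigroup C N M t ?f"
  \<comment> \<open>The semigroup function read on the empirical measure, through an arbitrary
    representative configuration.\<close>
  define H where "H x = ?P (SOME z. z \<in> configs C N M \<and> ?e z = x)" for x
  have "lumped C N M ?P"
    by (rule lumped_semigroup) (simp add: lumped_def)
  have H: "?P z = H (?e z)" if "z \<in> configs C N M" for z
  proof -
    let ?z = "SOME w. w \<in> configs C N M \<and> ?e w = ?e z"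
    have "?z \<in> configs C N M \<and> ?e ?z = ?e z"
      by (rule someI[of _ z]) (use that in simp)
    then have "?P z = ?P ?z"
      by (intro lumpedD[OF \<open>lumped C N M ?P\<close> that]) auto
    then show ?thesis by (simp only: H_def)
  qed
  have "measure_pmf.expectation \<mu> ?P = measure_pmf.expectation \<mu> (\<lambda>z. H (?e z))"
    unfolding expectation_configs[OF \<mu>(1)] by (simp add: H)
  also have "\<dots> = measure_pmf.expectation (uniform_empirical C N M) H"
    by (simp flip: \<mu>(2))
  also have "\<dots> = (\<Sum>z\<in>configs C N M. ?P z) / real (card (configs C N M))"
    unfolding expectation_uniform_empirical[OF ne] by (simp add: H)
  also have "\<dots> = (\<Sum>z\<in>configs C N M. ?f z) / real (card (configs C N M))"
    by (simp only: sum_semigroup)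
  also have "\<dots> = measure_pmf.expectation (uniform_empirical C N M) (\<lambda>x. of_bool (x = y))"
    unfolding expectation_uniform_empirical[OF ne] ..
  also have "\<dots> = pmf (uniform_empirical C N M) y"
    by (subst integral_measure_pmf[of "{y}"]) auto
  finally show "measure_pmf.expectation \<mu> ?P = pmf (uniform_empirical C N M) y" .
qed

lemma triple_sum_nonneg_eq_0:
  fixes d :: "'a \<Rightarrow> 'b \<Rightarrow> 'c \<Rightarrow> real"
  assumes sum: "(\<Sum>x\<in>A. \<Sum>y\<in>B x. \<Sum>z\<in>D x y. d x y z) = 0"
    and fin: "finite A" "finite (B x)" "finite (D x y)"
    and nonneg: "\<And>x y z. 0 \<le> d x y z"
    and mem: "x \<in> A" "y \<in> B x" "z \<in> D x y"
  shows "d x y z = 0"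
proof -
  have "(\<Sum>y\<in>B x. \<Sum>z\<in>D x y. d x y z) = 0"
    using sum mem(1) by (subst (asm) sum_nonneg_eq_0_iff[OF fin(1)]) (auto intro!: sum_nonneg nonneg)
  then have "(\<Sum>z\<in>D x y. d x y z) = 0"
    using mem(2) by (subst (asm) sum_nonneg_eq_0_iff[OF fin(2)]) (auto intro!: sum_nonneg nonneg)
  then show ?thesis
    using mem(3) by (subst (asm) sum_nonneg_eq_0_iff[OF fin(3)]) (auto intro!: nonneg)
qed

text \<open>
  The density \<open>h\<close> of the exchangeable lift of an invariant distribution is harmonic in the weak sense,
  so its Dirichlet form vanishes.
\<close>

lemma invariant_dist_unique:
  assumes ne: "configs C N M \<noteq> {}" and N: "1 \<le> N" and p: "invariant_dist C N M p"
  shows "p = uniform_empirical C N M"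
proof -
  let ?e = "empirical N M"
  let ?K = "configs C N M"
  define fib where "fib y = {z \<in> ?K. ?e z = y}" for y
  define h where "h y = pmf p y / real (card (fib y))" for y
  have fin: "finite (fib y)" for y by (simp add: fib_def finite_configs)
  have set_p: "set_pmf p \<subseteq> ?e ` ?K"
    using p by (simp add: invariant_dist_def empirical_states_eq[OF N])
  have fib_ne: "fib y \<noteq> {}" if "y \<in> ?e ` ?K" for y
    using that by (auto simp: fib_def)
  have set_fib: "set_pmf (pmf_of_set (fib y)) = fib y" if "y \<in> ?e ` ?K" for y
    by (rule set_pmf_of_set[OF fib_ne[OF that] fin])
  \<comment> \<open>This lift is uniform on each fibre, so that its mass function depends only on
    the empirical measure.\<close>
  define \<mu> where "\<mu> = bind_pmf p (\<lambda>y. pmf_of_set (fib y))"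
  have set_\<mu>: "set_pmf \<mu> \<subseteq> ?K"
    using set_p set_fib by (fastforce simp: \<mu>_def fib_def)
  have "map_pmf ?e \<mu> = bind_pmf p (\<lambda>y. map_pmf ?e (pmf_of_set (fib y)))"
    by (simp add: \<mu>_def map_bind_pmf)
  also have "\<dots> = bind_pmf p return_pmf"
  proof (rule bind_pmf_cong)
    fix y assume "y \<in> set_pmf p"
    then have y: "y \<in> ?e ` ?K" using set_p by auto
    have "map_pmf ?e (pmf_of_set (fib y)) = map_pmf (\<lambda>_. y) (pmf_of_set (fib y))"
      by (rule map_pmf_cong) (use set_fib[OF y] in \<open>auto simp: fib_def\<close>)
    then show "map_pmf ?e (pmf_of_set (fib y)) = return_pmf y" by simp
  qed simp
  finally have map_\<mu>: "map_pmf ?e \<mu> = p" by (simp add: bind_return_pmf')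
  have pmf_\<mu>: "pmf \<mu> z = h (?e z)" if z: "z \<in> ?K" for z
  proof -
    have "pmf \<mu> z = (\<Sum>y\<in>?e ` ?K. pmf p y * pmf (pmf_of_set (fib y)) z)"
      unfolding \<mu>_def pmf_bind
      using set_p by (subst integral_measure_pmf[of "?e ` ?K"]) (auto simp: finite_configs)
    also have "\<dots> = (\<Sum>y\<in>?e ` ?K. if y = ?e z then pmf p y / real (card (fib y)) else 0)"
    proof (rule sum.cong)
      fix y assume y: "y \<in> ?e ` ?K"
      have "pmf (pmf_of_set (fib y)) z = indicator (fib y) z / real (card (fib y))"
        by (rule pmf_of_set[OF fib_ne[OF y] fin])
      moreover have "z \<in> fib y \<longleftrightarrow> y = ?e z" using z by (auto simp: fib_def)
      ultimately show "pmf p y * pmf (pmf_of_set (fib y)) z = (if y = ?e z then pmf p y / real (card (fib y)) else 0)"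
        by (simp add: indicator_def)
    qed simp
    also have "\<dots> = h (?e z)"
      using z by (simp add: finite_configs h_def)
    finally show ?thesis .
  qed
  have "(\<Sum>z\<in>?K. h (?e z) * generator C N M (\<lambda>z. of_bool (?e z = y)) z) = 0" for y
  proof (rule weighted_sum_generator_eq_0)
    fix t :: real assume "0 \<le> t"
    then have "measure_pmf.expectation \<mu> (transition_semigroup C N M t (\<lambda>z. of_bool (?e z = y))) = pmf p y"
      using p set_\<mu> map_\<mu> unfolding invariant_dist_def by blast
    then show "(\<Sum>z\<in>?K. h (?e z) * transition_semigroup C N M t (\<lambda>z. of_bool (?e z = y)) z) = pmf p y"
      unfolding expectation_configs[OF set_\<mu>] by (simp add: pmf_\<mu>)
  qed
  \<comment> \<open>Weighting the indicator test functions by \<open>h y\<close> reassembles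
    \<open>h\<close> itself, which turns the pairing into a Dirichlet form.\<close>
  then have "0 = (\<Sum>y\<in>?e ` ?K. h y * (\<Sum>z\<in>?K. h (?e z) * generator C N M (\<lambda>z. of_bool (?e z = y)) z))"
    by simp
  also have "\<dots> = (\<Sum>z\<in>?K. h (?e z) * (\<Sum>y\<in>?e ` ?K. h y * generator C N M (\<lambda>z. of_bool (?e z = y)) z))"
    unfolding sum_distrib_left by (subst sum.swap) (simp add: mult_ac)
  also have "\<dots> = (\<Sum>z\<in>?K. h (?e z) * generator C N M (\<lambda>z. h (?e z)) z)"
  proof (intro sum.cong arg_cong2[where f = "(*)"] refl)
    fix z assume z: "z \<in> ?K"
    have "(\<Sum>y\<in>?e ` ?K. h y * generator C N M (\<lambda>z. of_bool (?e z = y)) z) =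
        (\<Sum>c<M. \<Sum>j\<in>targets C N M z c. \<Sum>y\<in>?e ` ?K.
          (h y * of_bool (?e (z(c := j)) = y) - h y * of_bool (?e z = y)) / real (card (targets C N M z c)))"
      unfolding generator_def sum_distrib_left
      by (subst sum.swap, intro sum.cong refl, subst sum.swap) (simp add: right_diff_distrib)
    also have "\<dots> = generator C N M (\<lambda>z. h (?e z)) z"
      unfolding generator_def
    proof (intro sum.cong refl)
      fix c j assume cj: "c \<in> {..<M}" "j \<in> targets C N M z c"
      have *: "(\<Sum>y\<in>?e ` ?K. h y * of_bool (?e w = y)) = h (?e w)" if "w \<in> ?K" for w
        using that finite_configs by (simp add: of_bool_def if_distrib cong: if_cong)
      show "(\<Sum>y\<in>?e ` ?K. (h y * of_bool (?e (z(c := j)) = y) - h y * of_bool (?e z = y)) / real (card (targets C N M z c))) =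
        (h (?e (z(c := j))) - h (?e z)) / real (card (targets C N M z c))"
        using cj z by (simp add: sum_divide_distrib[symmetric] sum_subtractf * configs_update)
    qed
    finally show "(\<Sum>y\<in>?e ` ?K. h y * generator C N M (\<lambda>z. of_bool (?e z = y)) z) = generator C N M (\<lambda>z. h (?e z)) z" .
  qed
  finally have "(\<Sum>z\<in>?K. \<Sum>c<M. \<Sum>j\<in>targets C N M z c.
      (h (?e (z(c := j))) - h (?e z)) * (h (?e (z(c := j))) - h (?e z)) / real (card (targets C N M z c))) = 0"
    (is "(\<Sum>z\<in>?K. \<Sum>c<M. \<Sum>j\<in>targets C N M z c. ?d z c j) = 0")
    unfolding generator_dirichlet by simp
  then have d: "?d z c j = 0" if "z \<in> ?K" "c < M" "j \<in> targets C N M z c" for z c j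
    by (rule triple_sum_nonneg_eq_0) (use that finite_configs in auto)
  have jump: "h (?e (z(c := j))) = h (?e z)" if "z \<in> ?K" "c < M" "j \<in> targets C N M z c" for z c j
  proof -
    have "card (targets C N M z c) \<noteq> 0" using that by auto
    moreover have "?d z c j = 0" using d[OF that] .
    ultimately show ?thesis by simp
  qed
  have "lumped C N M (\<lambda>z. h (?e z))"
    unfolding lumped_def by (intro ballI impI) (erule arg_cong)
  then have "h (?e z) = h (?e z')" if "z \<in> ?K" "z' \<in> ?K" for z z'
    by (rule const_of_jump_invariant) (fact jump that)+
  moreover obtain z0 where "z0 \<in> ?K" using ne by auto
  moreover define h0 where "h0 = h (?e z0)"
  ultimately have h0: "pmf \<mu> z = h0" if "z \<in> ?K" for z
    using that pmf_\<mu>[OF that] by metis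
  have "(\<Sum>z\<in>?K. pmf \<mu> z) = 1"
    by (rule sum_pmf_eq_1[OF finite_configs set_\<mu>])
  then have "real (card ?K) * h0 = 1" by (simp add: h0)
  moreover have "real (card ?K) \<noteq> 0" using ne finite_configs by simp
  ultimately have h0_eq: "h0 = 1 / real (card ?K)" by (simp add: eq_divide_eq mult.commute)
  have "pmf \<mu> z = pmf (pmf_of_set ?K) z" for z
  proof (cases "z \<in> ?K")
    case True
    then show ?thesis by (simp add: h0 h0_eq pmf_of_set[OF ne finite_configs])
  next
    case False
    then have "z \<notin> set_pmf \<mu>" using set_\<mu> by blast
    then show ?thesis using False by (simp add: pmf_of_set[OF ne finite_configs] pmf_eq_0_set_pmf)
  qed
  then have "\<mu> = pmf_of_set ?K" by (rule pmf_eqI)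
  then show ?thesis using map_\<mu> by (simp add: uniform_empirical_def)
qed

lemma stationary_eq:
  assumes "configs C N M \<noteq> {}" "1 \<le> N"
  shows "stationary C N M = uniform_empirical C N M"
  unfolding stationary_def
  using invariant_dist_uniform_empirical[OF assms] invariant_dist_unique[OF assms]
  by (intro the_equality)

section \<open>Concentration\<close>

text \<open>For \<open>i \<noteq> j\<close>, counts the customers of \<open>i\<close> whose jump to
  \<open>j\<close> turns occupancies \<open>(n + 1, m)\<close> into \<open>(n, m + 1)\<close>, minus
  those of \<open>j\<close> whose jump to \<open>i\<close> does the opposite.\<close>

definition pair_flux :: "nat \<Rightarrow> nat \<Rightarrow> nat \<Rightarrow> nat \<Rightarrow> nat \<Rightarrow> (nat \<Rightarrow> nat) \<Rightarrow> real" where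
  "pair_flux M n m i j z =
     real (Suc n) * of_bool (occupancy M z i = Suc n \<and> occupancy M z j = m)
     - real (Suc m) * of_bool (occupancy M z i = n \<and> occupancy M z j = Suc m)"

text \<open>
  The jumps from \<open>i\<close> to \<open>j\<close> out of occupancies \<open>n + 1, m\<close> are the reversals of the jumps from \<open>j\<close>
  to \<open>i\<close> out of occupancies \<open>n, m + 1\<close>.
\<close>

lemma sum_pair_flux:
  assumes ij: "i < N" "j < N" "i \<noteq> j" and nm: "n < C" "m < C"
    and \<phi>: "\<And>z c. c < M \<Longrightarrow> z c = j \<Longrightarrow> \<phi> (z(c := i)) = \<phi> z"
  shows "(\<Sum>z\<in>configs C N M. pair_flux M n m i j z * \<phi> z) = 0"
proof -
  let ?K = "configs C N M"
  \<comment> \<open>\<open>\<phi>\<close> is read at the source of the jump. In the reversed sum the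
    source is \<open>z(c := i)\<close>, and the hypothesis on \<open>\<phi>\<close> restores
    \<open>\<phi> z\<close>.\<close>
  define \<Psi> where "\<Psi> c z z' = of_bool (z c = i \<and> z' c = j \<and> occupancy M z i = Suc n \<and> occupancy M z j = m) * \<phi> z"
    for c :: nat and z z'
  have count: "(\<Sum>c<M. of_bool (z c = a)) = real (occupancy M z a)" for z a
    by (simp add: occupancy_def Int_def)
  have fwd: "(\<Sum>c<M. \<Sum>k\<in>targets C N M z c. \<Psi> c z (z(c := k))) =
      real (Suc n) * of_bool (occupancy M z i = Suc n \<and> occupancy M z j = m) * \<phi> z" for z
  proof -
    define P where "P \<longleftrightarrow> occupancy M z i = Suc n \<and> occupancy M z j = m"
    have "(\<Sum>k\<in>targets C N M z c. \<Psi> c z (z(c := k))) = of_bool P * \<phi> z * of_bool (z c = i)" for c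
    proof -
      have "(\<Sum>k\<in>targets C N M z c. \<Psi> c z (z(c := k))) =
          (\<Sum>k\<in>targets C N M z c. if k = j then of_bool P * \<phi> z * of_bool (z c = i) else 0)"
        by (intro sum.cong) (auto simp: \<Psi>_def P_def)
      \<comment> \<open>\<open>m < C\<close> leaves room at \<open>j\<close>; in the reversed sum,
        \<open>n < C\<close> leaves room at \<open>i\<close>.\<close>
      moreover have "j \<in> targets C N M z c" if P "z c = i"
        using that ij nm by (auto simp: targets_def P_def)
      ultimately show ?thesis by auto
    qed
    then have "(\<Sum>c<M. \<Sum>k\<in>targets C N M z c. \<Psi> c z (z(c := k))) =
        of_bool P * \<phi> z * (\<Sum>c<M. of_bool (z c = i))"
      by (simp only: sum_distrib_left)
    also have "\<dots> = real (Suc n) * of_bool P * \<phi> z"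
      unfolding count by (auto simp: P_def)
    finally show ?thesis by (simp only: P_def)
  qed
  have bwd: "(\<Sum>c<M. \<Sum>k\<in>targets C N M z c. \<Psi> c (z(c := k)) z) =
      real (Suc m) * of_bool (occupancy M z i = n \<and> occupancy M z j = Suc m) * \<phi> z" for z
  proof -
    define P where "P \<longleftrightarrow> occupancy M z i = n \<and> occupancy M z j = Suc m"
    have "(\<Sum>k\<in>targets C N M z c. \<Psi> c (z(c := k)) z) = of_bool P * \<phi> z * of_bool (z c = j)" if c: "c < M" for c
    proof -
      have "\<Psi> c (z(c := k)) z = (if k = i then of_bool P * \<phi> z * of_bool (z c = j) else 0)" for k
      proof (cases "k = i \<and> z c = j")
        case True
        then have "occupancy M (z(c := k)) i = Suc (occupancy M z i)"
          "occupancy M (z(c := k)) j = occupancy M z j - 1"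
          using c ij by (auto simp: occupancy_update)
        moreover have "0 < occupancy M z j"
          using occupancy_pos[OF c, of z] True by simp
        ultimately show ?thesis
          using True \<phi>[OF c] by (auto simp: \<Psi>_def P_def)
      qed (auto simp: \<Psi>_def)
      moreover have "i \<in> targets C N M z c" if P "z c = j"
        using that ij nm by (auto simp: targets_def P_def)
      ultimately show ?thesis by auto
    qed
    then have "(\<Sum>c<M. \<Sum>k\<in>targets C N M z c. \<Psi> c (z(c := k)) z) =
        of_bool P * \<phi> z * (\<Sum>c<M. of_bool (z c = j))"
      unfolding sum_distrib_left by (intro sum.cong refl) simp
    also have "\<dots> = real (Suc m) * of_bool P * \<phi> z"
      unfolding count by (auto simp: P_def)
    finally show ?thesis by (simp only: P_def)
  qed
  have "(\<Sum>z\<in>?K. \<Sum>c<M. \<Sum>k\<in>targets C N M z c. \<Psi> c z (z(c := k))) =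
      (\<Sum>z\<in>?K. \<Sum>c<M. \<Sum>k\<in>targets C N M z c. \<Psi> c (z(c := k)) z)"
    by (rule sum_jumps_reverse)
  then show ?thesis
    unfolding fwd bwd pair_flux_def left_diff_distrib sum_subtractf by simp
qed

lemma abs_pair_flux_le:
  assumes "n < C" "m < C"
  shows "\<bar>pair_flux M n m i j z\<bar> \<le> real C"
  using assms by (auto simp: pair_flux_def)

lemma pair_flux_cong:
  "occupancy M z i = occupancy M z' i \<Longrightarrow> occupancy M z j = occupancy M z' j \<Longrightarrow>
    pair_flux M n m i j z = pair_flux M n m i j z'"
  by (simp add: pair_flux_def)

text \<open>Vanishes when the ratios \<open>(n + 1) * y (n + 1) / y n\<close> agree at
  \<open>n\<close> and \<open>m\<close>; cross-multiplied, it makes sense also where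
  \<open>y\<close> is zero.\<close>

definition imbalance :: "nat \<Rightarrow> nat \<Rightarrow> (nat \<Rightarrow> real) \<Rightarrow> real" where
  "imbalance n m y = real (Suc n) * y (Suc n) * y m - real (Suc m) * y n * y (Suc m)"

text \<open>The diagonal \<open>i = j\<close>, where \<open>sum_pair_flux\<close> says nothing, is
  part of the double sum; it is of lower order in \<open>N\<close>.\<close>

lemma imbalance_empirical:
  assumes "1 \<le> N"
  shows "(real N)\<^sup>2 * imbalance n m (empirical N M z) = (\<Sum>i<N. \<Sum>j<N. pair_flux M n m i j z)"
proof -
  define X where "X a = (\<Sum>i<N. of_bool (occupancy M z i = a) :: real)" for a
  have e: "empirical N M z a = X a / real N" for a
    by (simp add: empirical_def X_def)
  have XX: "X a * X b = (\<Sum>i<N. \<Sum>j<N. of_bool (occupancy M z i = a \<and> occupancy M z j = b))" for a b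
    unfolding X_def sum_product of_bool_conj ..
  have "(\<Sum>i<N. \<Sum>j<N. pair_flux M n m i j z) = real (Suc n) * (X (Suc n) * X m) - real (Suc m) * (X n * X (Suc m))"
    unfolding pair_flux_def XX sum_subtractf sum_distrib_left ..
  also have "\<dots> = (real N)\<^sup>2 * imbalance n m (empirical N M z)"
    using assms by (simp add: imbalance_def e field_simps power2_eq_square del: of_nat_Suc)
  finally show ?thesis ..
qed

text \<open>The square expands over quadruples \<open>(i, j, k, l)\<close>. If
  \<open>i \<noteq> j\<close> and neither is \<open>k\<close> or \<open>l\<close>, a jump between
  \<open>i\<close> and \<open>j\<close> leaves the second factor unchanged, and
  \<open>sum_pair_flux\<close> annihilates the term. The others are at most \<open>C ^ 2\<close> per
  configuration.\<close>

lemma sum_imbalance_sq_le: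
  assumes N: "1 \<le> N" and nm: "n < C" "m < C"
  shows "(\<Sum>z\<in>configs C N M. (imbalance n m (empirical N M z))\<^sup>2)
    \<le> 5 * (real C)\<^sup>2 / real N * real (card (configs C N M))"
proof -
  let ?K = "configs C N M"
  let ?A = "pair_flux M n m"
  let ?B = "(real C)\<^sup>2 * real (card ?K)"
  \<comment> \<open>At least 1 as soon as one of the five coincidences occurs; each coincidence
    leaves \<open>N ^ 3\<close> quadruples, whence the constant 5.\<close>
  define w where "w i j k l = (of_bool (i = j) + of_bool (i = k) + of_bool (i = l) + of_bool (j = k) + of_bool (j = l) :: real)"
    for i j k l :: nat
  have term_le: "(\<Sum>z\<in>?K. ?A i j z * ?A k l z) \<le> ?B * w i j k l" if "i < N" "j < N" for i j k l
  proof (cases "i = j \<or> i = k \<or> i = l \<or> j = k \<or> j = l")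
    case True
    then have "1 \<le> w i j k l" by (auto simp: w_def)
    have "(\<Sum>z\<in>?K. ?A i j z * ?A k l z) \<le> (\<Sum>z\<in>?K. real C * real C)"
    proof (rule sum_mono)
      fix z
      have "?A i j z * ?A k l z \<le> \<bar>?A i j z\<bar> * \<bar>?A k l z\<bar>"
        by (metis abs_ge_self abs_mult)
      also have "\<dots> \<le> real C * real C"
        using abs_pair_flux_le[OF nm] by (intro mult_mono) auto
      finally show "?A i j z * ?A k l z \<le> real C * real C" .
    qed
    also have "\<dots> = ?B" by (simp add: power2_eq_square)
    also have "\<dots> \<le> ?B * w i j k l"
      using mult_left_mono[OF \<open>1 \<le> w i j k l\<close>, of ?B] by simp
    finally show ?thesis .
  next
    case False
    have "(\<Sum>z\<in>?K. ?A i j z * ?A k l z) = 0"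
    proof (rule sum_pair_flux)
      fix z c assume "c < M" "z c = j"
      then show "?A k l (z(c := i)) = ?A k l z"
        using False by (intro pair_flux_cong) (auto simp: occupancy_update)
    qed (use that nm False in auto)
    then show ?thesis by (simp add: w_def)
  qed
  have "(real N)^4 * (\<Sum>z\<in>?K. (imbalance n m (empirical N M z))\<^sup>2) =
      (\<Sum>z\<in>?K. ((real N)\<^sup>2 * imbalance n m (empirical N M z))\<^sup>2)"
    by (simp add: sum_distrib_left power_mult_distrib flip: power_mult)
  also have "\<dots> = (\<Sum>z\<in>?K. \<Sum>i<N. \<Sum>j<N. \<Sum>k<N. \<Sum>l<N. ?A i j z * ?A k l z)"
    unfolding imbalance_empirical[OF N]
    by (simp only: power2_eq_square sum_distrib_right) (simp only: sum_distrib_left)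
  also have "\<dots> = (\<Sum>i<N. \<Sum>j<N. \<Sum>k<N. \<Sum>l<N. \<Sum>z\<in>?K. ?A i j z * ?A k l z)"
    by (simp only: sum.swap[of _ "{..<N}" ?K])
  also have "\<dots> \<le> (\<Sum>i<N. \<Sum>j<N. \<Sum>k<N. \<Sum>l<N. ?B * w i j k l)"
    by (intro sum_mono term_le) auto
  also have "\<dots> = ?B * (\<Sum>i<N. \<Sum>j<N. \<Sum>k<N. \<Sum>l<N. w i j k l)"
    by (simp only: sum_distrib_left)
  also have "(\<Sum>i<N. \<Sum>j<N. \<Sum>k<N. \<Sum>l<N. w i j k l) = 5 * (real N)^3"
    by (simp add: w_def sum.distrib of_bool_def power3_eq_cube flip: sum_distrib_left)
  finally have "(real N)^3 * (real N * (\<Sum>z\<in>?K. (imbalance n m (empirical N M z))\<^sup>2)) \<le> (real N)^3 * (5 * ?B)"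
    by (simp add: power4_eq_xxxx power3_eq_cube mult_ac)
  then have "real N * (\<Sum>z\<in>?K. (imbalance n m (empirical N M z))\<^sup>2) \<le> 5 * ?B"
    using N by (subst (asm) mult_le_cancel_left_pos) auto
  then show ?thesis using N by (simp add: field_simps)
qed

section \<open>Identification of the limit and weak convergence\<close>

text \<open>A penalty that vanishes on probability vectors only at the limit point; the mean enters
  because \<open>M / N\<close> is only close to \<open>lam\<close>.\<close>

definition discrepancy :: "nat \<Rightarrow> real \<Rightarrow> (nat \<Rightarrow> real) \<Rightarrow> real" where
  "discrepancy C lam y = (\<Sum>n<C. \<Sum>m<C. (imbalance n m y)\<^sup>2) + (mean C y - lam)\<^sup>2"

lemma discrepancy_nonneg: "0 \<le> discrepancy C lam y"
  by (auto simp: discrepancy_def intro!: add_nonneg_nonneg sum_nonneg)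

lemma continuous_on_discrepancy: "continuous_on S (discrepancy C lam)"
  unfolding discrepancy_def imbalance_def mean_def
  by (intro continuous_intros continuous_on_subset[OF continuous_on_product_coordinates]) auto

text \<open>There are \<open>C ^ 2\<close> pairs of levels, each contributing at most
  \<open>5 * C ^ 2 / N\<close>; hence the fourth power.\<close>

lemma expectation_discrepancy_le:
  assumes ne: "configs C N M \<noteq> {}" and N: "1 \<le> N"
  shows "measure_pmf.expectation (uniform_empirical C N M) (discrepancy C lam)
    \<le> 5 * real C ^ 4 / real N + (real M / real N - lam)\<^sup>2"
proof -
  let ?K = "configs C N M"
  have K: "0 < real (card ?K)" using ne finite_configs by (simp add: card_gt_0_iff)
  have "(\<Sum>z\<in>?K. discrepancy C lam (empirical N M z)) =
      (\<Sum>z\<in>?K. \<Sum>n<C. \<Sum>m<C. (imbalance n m (empirical N M z))\<^sup>2)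
        + real (card ?K) * (real M / real N - lam)\<^sup>2"
    by (simp add: discrepancy_def sum.distrib mean_empirical)
  also have "(\<Sum>z\<in>?K. \<Sum>n<C. \<Sum>m<C. (imbalance n m (empirical N M z))\<^sup>2) =
      (\<Sum>n<C. \<Sum>m<C. \<Sum>z\<in>?K. (imbalance n m (empirical N M z))\<^sup>2)"
    by (simp only: sum.swap[of _ "{..<C}" ?K])
  also have "\<dots> \<le> (\<Sum>n<C. \<Sum>m<C. 5 * (real C)\<^sup>2 / real N * real (card ?K))"
    by (intro sum_mono sum_imbalance_sq_le[OF N]) auto
  also have "\<dots> = real (card ?K) * (5 * real C ^ 4 / real N)"
    by (simp add: power2_eq_square power4_eq_xxxx)
  finally have "(\<Sum>z\<in>?K. discrepancy C lam (empirical N M z)) \<le>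
      (5 * real C ^ 4 / real N + (real M / real N - lam)\<^sup>2) * real (card ?K)"
    by (simp add: algebra_simps)
  then show ?thesis
    unfolding expectation_uniform_empirical[OF ne] using K by (simp add: pos_divide_le_eq)
qed

text \<open>Summing imbalances over \<open>m < C\<close> brings in the mass below \<open>C\<close>
  and the mean, and leaves the truncated Poisson recursion with rate \<open>lam / (1 - y C)\<close>;
  uniqueness of the rate of mean \<open>lam\<close> identifies it.\<close>

lemma discrepancy_eq_0:
  assumes C: "1 \<le> C" "0 < lam" "lam < real C"
    and y: "y \<in> prob_vectors C" and 0: "discrepancy C lam y = 0"
  shows "y = nu C (rho_mean C lam)"
proof -
  have nn: "0 \<le> (\<Sum>n<C. \<Sum>m<C. (imbalance n m y)\<^sup>2)" by (intro sum_nonneg) auto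
  then have m: "mean C y = lam" and s: "(\<Sum>n<C. \<Sum>m<C. (imbalance n m y)\<^sup>2) = 0"
    using 0 by (auto simp: discrepancy_def add_nonneg_eq_0_iff)
  have im: "imbalance n m y = 0" if "n < C" "m < C" for n m
  proof -
    have "(\<Sum>m<C. (imbalance n m y)\<^sup>2) = 0"
      using s that by (subst (asm) sum_nonneg_eq_0_iff) (auto intro!: sum_nonneg)
    then show ?thesis
      using that by (subst (asm) sum_nonneg_eq_0_iff) auto
  qed
  have yC: "y C < 1"
    by (rule last_less_1[OF C(1,3)]) (use y m in \<open>simp add: prob_vectors_mean_def\<close>)
  define r where "r = lam / (1 - y C)"
  have r: "0 < r" using C yC by (simp add: r_def)
  have S1: "(\<Sum>m<C. y m) = 1 - y C"
    using y by (simp add: prob_vectors_def lessThan_Suc_atMost[symmetric])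
  have S2: "(\<Sum>m<C. real (Suc m) * y (Suc m)) = lam"
  proof -
    have "mean C y = (\<Sum>n<Suc C. real n * y n)"
      by (simp add: mean_def lessThan_Suc_atMost)
    then show ?thesis using m by (simp add: sum.lessThan_Suc_shift del: sum.lessThan_Suc)
  qed
  have step: "real (Suc n) * y (Suc n) = r * y n" if "n < C" for n
  proof -
    have "0 = (\<Sum>m<C. imbalance n m y)" using im[OF that] by simp
    also have "\<dots> = real (Suc n) * y (Suc n) * (\<Sum>m<C. y m) - y n * (\<Sum>m<C. real (Suc m) * y (Suc m))"
      unfolding sum_distrib_left sum_subtractf[symmetric] imbalance_def
      by (intro sum.cong refl) (simp only: mult_ac)
    also have "\<dots> = real (Suc n) * y (Suc n) * (1 - y C) - y n * lam"
      unfolding S1 S2 ..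
    finally show ?thesis using yC by (simp add: r_def field_simps)
  qed
  have form: "y n = y 0 * (r ^ n / fact n)" if "n \<le> C" for n
    using that
  proof (induction n)
    case (Suc n)
    then have "real (Suc n) * y (Suc n) = r * (y 0 * (r ^ n / fact n))"
      using step[of n] by simp
    then have "y (Suc n) = r * (y 0 * (r ^ n / fact n)) / real (Suc n)"
      by (simp add: eq_divide_eq mult_ac del: of_nat_Suc)
    then show ?case by (simp add: mult_ac del: of_nat_Suc)
  qed simp
  define Z where "Z = (\<Sum>k\<le>C. r ^ k / fact k)"
  have "y 0 * Z = (\<Sum>n\<le>C. y n)"
    unfolding Z_def sum_distrib_left by (intro sum.cong refl form[symmetric]) simp
  then have "y 0 * Z = 1" using y by (simp add: prob_vectors_def)
  then have y0: "y 0 = 1 / Z" by (auto simp: eq_divide_eq)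
  have "y = nu C r"
  proof
    fix n show "y n = nu C r n"
    proof (cases "n \<le> C")
      case True
      show ?thesis unfolding form[OF True] y0 using True by (simp add: nu_def Z_def)
    qed (use y in \<open>simp add: nu_def prob_vectors_def orthant_def\<close>)
  qed
  moreover have "r = rho_mean C lam"
    using rho_mean_unique[OF C r] m \<open>y = nu C r\<close> by simp
  ultimately show ?thesis by simp
qed

text \<open>A closed subset of an infinite product of unit intervals, compact by Tychonoff.\<close>

lemma compact_prob_vectors: "compact (prob_vectors C)"
proof -
  have "compactin (product_topology (\<lambda>_::nat. euclideanreal) UNIV) (PiE UNIV (\<lambda>_. {0..1}))"
    by (simp add: compactin_PiE)
  then have box: "compact (PiE UNIV (\<lambda>_::nat. {0..1::real}))"
    by (simp only: euclidean_product_topology compactin_euclidean_iff)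
  have coord: "continuous_on UNIV (\<lambda>y::nat \<Rightarrow> real. y n)" for n by simp
  have "prob_vectors C =
      (\<Inter>n\<in>{..C}. {y. 0 \<le> y n}) \<inter> (\<Inter>n\<in>{C<..}. {y. y n = 0}) \<inter> {y. (\<Sum>n\<le>C. y n) = 1}"
    by (auto simp: prob_vectors_def orthant_def)
  moreover have "closed ((\<Inter>n\<in>{..C}. {y. 0 \<le> y n}) \<inter> (\<Inter>n\<in>{C<..}. {y. y n = 0}) \<inter> {y::nat \<Rightarrow> real. (\<Sum>n\<le>C. y n) = 1})"
    by (intro closed_Int closed_INT ballI closed_Collect_le closed_Collect_eq continuous_intros coord)
  ultimately have "closed (prob_vectors C)" by simp
  moreover have "prob_vectors C \<subseteq> PiE UNIV (\<lambda>_. {0..1})"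
  proof
    fix y assume y: "y \<in> prob_vectors C"
    have "y n \<in> {0..1}" for n
    proof (cases "n \<le> C")
      case True
      have "y n \<le> (\<Sum>n\<le>C. y n)"
        by (rule member_le_sum) (use True y in \<open>auto simp: prob_vectors_def orthant_def\<close>)
      then show ?thesis using True y by (auto simp: prob_vectors_def orthant_def)
    qed (use y in \<open>auto simp: prob_vectors_def orthant_def\<close>)
    then show "y \<in> PiE UNIV (\<lambda>_. {0..1})" by auto
  qed
  ultimately show ?thesis
    using compact_Int_closed[OF box] by (metis inf.absorb2)
qed

text \<open>On the compact set where \<open>f \<ge> \<delta>\<close>, \<open>V\<close> has a
  positive minimum; \<open>K\<close> is the maximum of \<open>f\<close> divided by it. A small
  expectation of \<open>V\<close> thus controls that of \<open>f\<close>, without extracting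
  subsequences.\<close>

lemma continuous_le_zero_set_penalty:
  fixes f V :: "'a::topological_space \<Rightarrow> real"
  assumes S: "compact S" and f: "continuous_on S f" and V: "continuous_on S V"
    and V0: "\<And>y. y \<in> S \<Longrightarrow> 0 \<le> V y" "\<And>y. y \<in> S \<Longrightarrow> V y = 0 \<Longrightarrow> f y \<le> 0" and "0 < \<delta>"
  obtains K where "0 \<le> K" "\<And>y. y \<in> S \<Longrightarrow> f y \<le> \<delta> + K * V y"
proof -
  define T where "T = S \<inter> f -` {\<delta>..}"
  have "closedin (top_of_set S) T"
    unfolding T_def using f by (rule continuous_closedin_preimage) simp
  then have T: "compact T" using S closedin_compact by blast
  have TS: "T \<subseteq> S" by (auto simp: T_def)
  show ?thesis
  proof (cases "T = {}")
    case True
    then have "f y \<le> \<delta> + 0 * V y" if "y \<in> S" for y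
      using that by (force simp: T_def)
    then show ?thesis by (intro that[of 0]) auto
  next
    case False
    obtain y0 where y0: "y0 \<in> T" "\<And>y. y \<in> T \<Longrightarrow> V y0 \<le> V y"
      using continuous_attains_inf[OF T False continuous_on_subset[OF V TS]] by blast
    have "V y0 \<noteq> 0" using y0(1) V0(2)[of y0] \<open>0 < \<delta>\<close> by (auto simp: T_def)
    then have "0 < V y0" using V0(1)[of y0] y0(1) TS by fastforce
    obtain y1 where y1: "y1 \<in> T" "\<And>y. y \<in> T \<Longrightarrow> f y \<le> f y1"
      using continuous_attains_sup[OF T False continuous_on_subset[OF f TS]] by blast
    have "0 < f y1" using y1(1) \<open>0 < \<delta>\<close> by (auto simp: T_def)
    show ?thesis
    proof (rule that)
      show "0 \<le> f y1 / V y0" using \<open>0 < f y1\<close> \<open>0 < V y0\<close> by simp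
      fix y assume y: "y \<in> S"
      show "f y \<le> \<delta> + f y1 / V y0 * V y"
      proof (cases "y \<in> T")
        case True
        have "f y \<le> f y1 / V y0 * V y0" using y1(2)[OF True] \<open>0 < V y0\<close> by simp
        also have "\<dots> \<le> f y1 / V y0 * V y"
          using y0(2)[OF True] \<open>0 < f y1\<close> \<open>0 < V y0\<close> by (intro mult_left_mono) auto
        finally show ?thesis using \<open>0 < \<delta>\<close> by simp
      next
        case False
        then have "f y < \<delta>" using y by (auto simp: T_def)
        then show ?thesis
          using V0(1)[OF y] \<open>0 < f y1\<close> \<open>0 < V y0\<close> by (simp add: add_increasing2 less_imp_le)
      qed
    qed
  qed
qed

lemma weakly_converges_stationary:
  assumes C: "1 \<le> C" "0 < lam" "lam < real C"
    and M: "\<And>N. 1 \<le> N \<Longrightarrow> M N < N * C" and lim: "(\<lambda>N. real (M N) / real N) \<longlonglongrightarrow> lam"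
  shows "weakly_converges_on (prob_vectors C) (\<lambda>N. stationary C N (M N))
    (return_pmf (nu C (rho_mean C lam)))"
  unfolding weakly_converges_on_def
proof (intro allI impI)
  fix f :: "(nat \<Rightarrow> real) \<Rightarrow> real"
  assume f: "continuous_on (prob_vectors C) f"
  let ?v = "nu C (rho_mean C lam)" and ?S = "prob_vectors C"
  let ?E = "\<lambda>N. measure_pmf.expectation (stationary C N (M N))"
  have "(\<lambda>N. ?E N f) \<longlonglongrightarrow> f ?v"
  proof (rule LIMSEQ_I)
    fix \<epsilon> :: real assume "0 < \<epsilon>"
    \<comment> \<open>\<open>K\<close> depends on \<open>\<epsilon>\<close> but not on
      \<open>N\<close>, so the expected discrepancy can tend to 0 afterwards.\<close>
    obtain K where K: "0 \<le> K" "\<And>y. y \<in> ?S \<Longrightarrow> \<bar>f y - f ?v\<bar> \<le> \<epsilon> / 2 + K * discrepancy C lam y"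
    proof (rule continuous_le_zero_set_penalty[OF compact_prob_vectors])
      show "continuous_on ?S (\<lambda>y. \<bar>f y - f ?v\<bar>)"
        using f by (intro continuous_intros)
      show "0 < \<epsilon> / 2" using \<open>0 < \<epsilon>\<close> by simp
      show "\<bar>f y - f ?v\<bar> \<le> 0" if "y \<in> ?S" "discrepancy C lam y = 0" for y
        using discrepancy_eq_0[OF C that] by simp
    qed (use continuous_on_discrepancy discrepancy_nonneg in auto)
    have "(\<lambda>N. \<epsilon> / 2 + K * (5 * real C ^ 4 / real N + (real (M N) / real N - lam)\<^sup>2))
        \<longlonglongrightarrow> \<epsilon> / 2 + K * (0 + (lam - lam)\<^sup>2)"
      by (intro tendsto_intros lim lim_const_over_n)
    then have small: "\<forall>\<^sub>F N in sequentially.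
        \<epsilon> / 2 + K * (5 * real C ^ 4 / real N + (real (M N) / real N - lam)\<^sup>2) < \<epsilon>"
      by (rule order_tendstoD) (use \<open>0 < \<epsilon>\<close> in simp)
    have bound: "norm (?E N f - f ?v) \<le> \<epsilon> / 2 + K * (5 * real C ^ 4 / real N + (real (M N) / real N - lam)\<^sup>2)"
      if N: "1 \<le> N" for N
    proof -
      let ?K = "configs C N (M N)" and ?e = "empirical N (M N)"
      have ne: "?K \<noteq> {}" using M[OF N] by (intro configs_nonempty) auto
      have K0: "real (card ?K) > 0" using ne finite_configs by (simp add: card_gt_0_iff)
      note E = stationary_eq[OF ne N] expectation_uniform_empirical[OF ne]
      have "?E N f - f ?v = (\<Sum>z\<in>?K. f (?e z) - f ?v) / real (card ?K)"
        unfolding E using K0 by (simp add: sum_subtractf field_simps)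
      then have "norm (?E N f - f ?v) \<le> (\<Sum>z\<in>?K. \<bar>f (?e z) - f ?v\<bar>) / real (card ?K)"
        by (simp add: divide_right_mono)
      also have "\<dots> \<le> (\<Sum>z\<in>?K. \<epsilon> / 2 + K * discrepancy C lam (?e z)) / real (card ?K)"
        by (intro divide_right_mono sum_mono K(2) empirical_in_prob_vectors N) auto
      also have "\<dots> = \<epsilon> / 2 + K * measure_pmf.expectation (uniform_empirical C N (M N)) (discrepancy C lam)"
        unfolding E(2) sum.distrib sum_distrib_left[symmetric] using K0 by (simp add: add_divide_distrib)
      also have "\<dots> \<le> \<epsilon> / 2 + K * (5 * real C ^ 4 / real N + (real (M N) / real N - lam)\<^sup>2)"
        by (intro add_left_mono mult_left_mono expectation_discrepancy_le ne N K(1))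
      finally show ?thesis .
    qed
    have "\<forall>\<^sub>F N in sequentially. norm (?E N f - f ?v) < \<epsilon>"
      using small eventually_ge_at_top[of 1] by eventually_elim (rule le_less_trans[OF bound])
    then show "\<exists>no. \<forall>n\<ge>no. norm (?E n f - f ?v) < \<epsilon>"
      by (simp add: eventually_sequentially)
  qed
  then show "(\<lambda>N. ?E N f) \<longlonglongrightarrow> measure_pmf.expectation (return_pmf ?v) f"
    by simp
qed

theorem proposition4p3:
  fixes C :: nat and lam :: real
  assumes "1 \<le> C" and "0 < lam" and "lam < real C"
  shows
    "invariant_set C (drift_dom C) (drift C lam) (prob_vectors_mean C lam) \<and>
     lyapunov C (drift C lam) (prob_vectors_mean C lam)
       (\<lambda>y. rel_entropy C y (nu C (rho_mean C lam))) \<and>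
     (\<forall>M :: nat \<Rightarrow> nat.
        (\<forall>N\<ge>1. M N < N * C) \<longrightarrow>
        filterlim M at_top sequentially \<longrightarrow>
        (\<lambda>N. real (M N) / real N) \<longlonglongrightarrow> lam \<longrightarrow>
        weakly_converges_on (prob_vectors C) (\<lambda>N. stationary C N (M N))
          (return_pmf (nu C (rho_mean C lam))))"
proof (intro conjI allI impI)
  show "invariant_set C (drift_dom C) (drift C lam) (prob_vectors_mean C lam)"
    by (rule invariant_set_drift[OF assms])
  show "lyapunov C (drift C lam) (prob_vectors_mean C lam)
      (\<lambda>y. rel_entropy C y (nu C (rho_mean C lam)))"
    by (rule lyapunov_rel_entropy[OF assms rho_mean_pos[OF assms]])
next
  fix M :: "nat \<Rightarrow> nat"
  assume "\<forall>N\<ge>1. M N < N * C" "(\<lambda>N. real (M N) / real N) \<longlonglongrightarrow> lam"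
  then show "weakly_converges_on (prob_vectors C) (\<lambda>N. stationary C N (M N))
      (return_pmf (nu C (rho_mean C lam)))"
    by (intro weakly_converges_stationary assms) auto
qed

end
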